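(* For every $m,n\ge1$ and every $\varepsilon\in\{+,-\}^{n-1}$, there is an algorithmic bijection between the set of pairs $(\sigma,f)$ with $\sigma\in S_n$ and $f:P_\varepsilon\to[m]$ order-preserving, and the set of pairs $(\pi,\lambda)$ with $\pi\in S_n$ and $\lambda:\operatorname{Rec}_\varepsilon(\pi)\to[m]$ an arbitrary map.
   Context: $[m]=\{1,\ldots,m\}$. For $\varepsilon\in\{+,-\}^{n-1}$, $P_\varepsilon$ is the poset on $\{x_1,\ldots,x_n\}$ obtained as the transitive closure of $x_i\succ x_{i+1}$ if $\varepsilon_i=+$, and $x_i\prec x_{i+1}$ if $\varepsilon_i=-$, $1\le i\le n-1$. Order-preserving is in the weak sense. Greedy records: for $\pi\in S_n$, set $i_0=n$; once $i_j$ is chosen, let $A_j(\pi)$ be the set of $i<i_j$ such that $\pi_i>\pi_{i_j}$ if $\varepsilon_i=+$, and $\pi_i<\pi_{i_j}$ if $\varepsilon_i=-$; stop if it is empty, otherwise $i_{j+1}=\max A_j(\pi)$. Then $\operatorname{Rec}_\varepsilon(\pi)=\{i_0,i_1,\ldots,i_s\}$. *)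

theory Defs
  imports
    "HOL-Combinatorics.Permutations"
    "HOL-Library.FuncSet"
    "HOL-Library.Nat_Bijection"
begin

section \<open>Zigzag posets and greedy records\<close>

datatype step_sign = Plus | Minus

text \<open>
  A sign sequence is a list of length \<open>n - 1\<close>; its \<open>i\<close>-th entry, with
  \<open>1 \<le> i \<le> n - 1\<close>, is \<open>\<epsilon> ! (i - 1)\<close>. The element \<open>x_i\<close> of the poset is
  represented by its index \<open>i\<close>.
\<close>

definition sign_at :: "step_sign list \<Rightarrow> nat \<Rightarrow> step_sign" where
  "sign_at \<epsilon> i = \<epsilon> ! (i - 1)"

definition zigzag_step :: "nat \<Rightarrow> step_sign list \<Rightarrow> (nat \<times> nat) set" where
  "zigzag_step n \<epsilon> =
     {(Suc i, i) | i. 1 \<le> i \<and> i \<le> n - 1 \<and> sign_at \<epsilon> i = Plus} \<union>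
     {(i, Suc i) | i. 1 \<le> i \<and> i \<le> n - 1 \<and> sign_at \<epsilon> i = Minus}"

text \<open>\<open>zigzag_le n \<epsilon> a b\<close> is the reflexive order \<open>x_a \<preceq> x_b\<close>.\<close>

definition zigzag_le :: "nat \<Rightarrow> step_sign list \<Rightarrow> nat \<Rightarrow> nat \<Rightarrow> bool" where
  "zigzag_le n \<epsilon> a b \<longleftrightarrow> (a, b) \<in> (zigzag_step n \<epsilon>)\<^sup>*"

definition order_preserving_maps :: "nat \<Rightarrow> nat \<Rightarrow> step_sign list \<Rightarrow> (nat \<Rightarrow> nat) set" where
  "order_preserving_maps m n \<epsilon> =
     {f \<in> {1..n} \<rightarrow>\<^sub>E {1..m}. monotone_on {1..n} (zigzag_le n \<epsilon>) (\<le>) f}"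

definition record_candidates :: "step_sign list \<Rightarrow> (nat \<Rightarrow> nat) \<Rightarrow> nat \<Rightarrow> nat set" where
  "record_candidates \<epsilon> \<pi> k =
     {i. 1 \<le> i \<and> i < k \<and>
         (case sign_at \<epsilon> i of Plus \<Rightarrow> \<pi> i > \<pi> k | Minus \<Rightarrow> \<pi> i < \<pi> k)}"

inductive_set greedy_records :: "nat \<Rightarrow> step_sign list \<Rightarrow> (nat \<Rightarrow> nat) \<Rightarrow> nat set"
  for n :: nat and \<epsilon> :: "step_sign list" and \<pi> :: "nat \<Rightarrow> nat" where
  first: "n \<in> greedy_records n \<epsilon> \<pi>"
| step: "k \<in> greedy_records n \<epsilon> \<pi> \<Longrightarrow> record_candidates \<epsilon> \<pi> k \<noteq> {} \<Longrightarrow>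
    Max (record_candidates \<epsilon> \<pi> k) \<in> greedy_records n \<epsilon> \<pi>"

definition perm_order_pairs ::
    "nat \<Rightarrow> nat \<Rightarrow> step_sign list \<Rightarrow> ((nat \<Rightarrow> nat) \<times> (nat \<Rightarrow> nat)) set" where
  "perm_order_pairs m n \<epsilon> =
     {(\<sigma>, f). \<sigma> permutes {1..n} \<and> f \<in> order_preserving_maps m n \<epsilon>}"

definition perm_record_pairs ::
    "nat \<Rightarrow> nat \<Rightarrow> step_sign list \<Rightarrow> ((nat \<Rightarrow> nat) \<times> (nat \<Rightarrow> nat)) set" where
  "perm_record_pairs m n \<epsilon> =
     {(\<pi>, l). \<pi> permutes {1..n} \<and> l \<in> greedy_records n \<epsilon> \<pi> \<rightarrow>\<^sub>E {1..m}}"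


section \<open>Algorithms: total recursive functions\<close>

text \<open>
  \<open>total_recursive k f\<close>: the restriction of \<open>f\<close> to argument lists of length \<open>k\<close> is a total
  recursive function (Kleene's schemes, with minimization applied only to regular functions).
  Values on lists of any other length are irrelevant.
\<close>

inductive total_recursive :: "nat \<Rightarrow> (nat list \<Rightarrow> nat) \<Rightarrow> bool" where
  zero: "total_recursive k (\<lambda>xs. 0)"
| succ: "total_recursive 1 (\<lambda>xs. Suc (xs ! 0))"
| proj: "i < k \<Longrightarrow> total_recursive k (\<lambda>xs. xs ! i)"
| comp: "total_recursive (length gs) f \<Longrightarrow> (\<And>g. g \<in> set gs \<Longrightarrow> total_recursive k g) \<Longrightarrow>
    total_recursive k (\<lambda>xs. f (map (\<lambda>g. g xs) gs))"
| prec: "total_recursive k f \<Longrightarrow> total_recursive (k + 2) g \<Longrightarrow>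
    total_recursive (k + 1)
      (\<lambda>xs. rec_nat (f (tl xs)) (\<lambda>y r. g (y # r # tl xs)) (hd xs))"
| minim: "total_recursive (k + 1) f \<Longrightarrow>
    (\<And>xs. length xs = k \<Longrightarrow> \<exists>y. f (y # xs) = 0) \<Longrightarrow>
    total_recursive k (\<lambda>xs. LEAST y. f (y # xs) = 0)"

text \<open>
  Numerical codes of the combinatorial objects. A map with finite domain \<open>A\<close> is coded by the list
  of its values along \<open>A\<close> in increasing order. The domain is not part of the code: for
  \<open>code_record_pair\<close> it is determined by the first component \<open>\<pi>\<close>.
\<close>

definition code_signs :: "step_sign list \<Rightarrow> nat" where
  "code_signs \<epsilon> = list_encode (map (\<lambda>s. case s of Plus \<Rightarrow> 1 | Minus \<Rightarrow> 0) \<epsilon>)"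

definition code_map :: "nat set \<Rightarrow> (nat \<Rightarrow> nat) \<Rightarrow> nat" where
  "code_map A g = list_encode (map g (sorted_list_of_set A))"

definition code_order_pair :: "nat \<Rightarrow> (nat \<Rightarrow> nat) \<times> (nat \<Rightarrow> nat) \<Rightarrow> nat" where
  "code_order_pair n = (\<lambda>(\<sigma>, f). prod_encode (code_map {1..n} \<sigma>, code_map {1..n} f))"

definition code_record_pair ::
    "nat \<Rightarrow> step_sign list \<Rightarrow> (nat \<Rightarrow> nat) \<times> (nat \<Rightarrow> nat) \<Rightarrow> nat" where
  "code_record_pair n \<epsilon> =
     (\<lambda>(\<pi>, l). prod_encode (code_map {1..n} \<pi>, code_map (greedy_records n \<epsilon> \<pi>) l))"

text \<open>
  A family of bijections is algorithmic if one algorithm, taking the parameters \<open>m\<close>, \<open>n\<close>, \<open>\<epsilon>\<close> as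
  part of its input, computes all its members, and another one computes all their inverses.
  Uniformity in the parameters is essential: for fixed parameters the sets are finite and every
  map between them is computable.
\<close>

definition algorithmic_family ::
    "(nat \<Rightarrow> nat \<Rightarrow> step_sign list \<Rightarrow>
       (nat \<Rightarrow> nat) \<times> (nat \<Rightarrow> nat) \<Rightarrow> (nat \<Rightarrow> nat) \<times> (nat \<Rightarrow> nat)) \<Rightarrow> bool" where
  "algorithmic_family \<Phi> \<longleftrightarrow>
     (\<exists>F G. total_recursive 4 F \<and> total_recursive 4 G \<and>
       (\<forall>m n \<epsilon>. m \<ge> 1 \<longrightarrow> n \<ge> 1 \<longrightarrow> length \<epsilon> = n - 1 \<longrightarrow>
          (\<forall>x \<in> perm_order_pairs m n \<epsilon>.
             F [m, n, code_signs \<epsilon>, code_order_pair n x] = code_record_pair n \<epsilon> (\<Phi> m n \<epsilon> x) \<and>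
             G [m, n, code_signs \<epsilon>, code_record_pair n \<epsilon> (\<Phi> m n \<epsilon> x)] = code_order_pair n x)))"

end

theory Submission
  imports Defs "HOL-Library.More_List"
begin

text \<open>
  Both sets of pairs are encoded as finite sets of natural numbers, and membership in them is
  decidable uniformly in \<open>m\<close>, \<open>n\<close> and \<open>\<epsilon>\<close>. Once the two sets are known to have equally many
  elements, an algorithmic bijection sends the \<open>k\<close>-th smallest code of the first set to the
  \<open>k\<close>-th smallest code of the second one (\<open>rank_match\<close>). The search for the image ends because
  the cardinalities agree, and the inverse is computed by the same procedure with the two sets
  exchanged (\<open>computable_rank_match\<close>).

  The heart of the matter is therefore the identity
  \<open>n! * #{f : P\<^sub>\<epsilon> \<rightarrow> [m] order-preserving} = (\<Sum>\<pi>. m ^ |Rec\<^sub>\<epsilon>(\<pi>)|)\<close>.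
  Scan a permutation from right to left and remember only the value \<open>v\<close> of the last record found.
  Prepending an entry either makes this entry the new record, at the price of a factor \<open>m\<close>, or
  leaves the record as it is; which of the two happens depends on \<open>v\<close>, the new entry and one sign
  only. Likewise, prepending an element to the zigzag poset constrains its value by one sign and by
  the value at the old first element. The two recursions are intertwined by the kernel
  \<open>K(s, j, v) = (v + j - 2 choose j - 1) * (s - v + m - j choose m - j)\<close>,
  which is, up to normalization, the beta-binomial distribution: if \<open>t\<close> is the \<open>v\<close>-th smallest of
  \<open>s\<close> uniform random points, then \<open>K(s, j, v)\<close> is proportional to the probability that exactly
  \<open>j - 1\<close> of \<open>m - 1\<close> further points lie below \<open>t\<close>. Concretely (\<open>weighted_record_sum\<close>), for
  sign sequences of length \<open>s - 1\<close> and every \<open>j \<in> [m]\<close>,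
  \<open>(\<Sum>\<pi> \<in> S\<^sub>s. m ^ |Rec(\<pi>)| * K(s, j, v(\<pi>))) = m (m + 1) \<dots> (m + s - 1) * #{f : f(x\<^sub>1) = j}\<close>.
  This follows by induction on \<open>s\<close> from the binomial identity \<open>kernel_record_step\<close>. Summing over
  \<open>j\<close> removes the kernel, because its sum over \<open>j\<close> does not depend on \<open>v\<close> (\<open>kernel_sum\<close>), and what
  remains is the desired identity (\<open>record_generating_sum\<close>).
\<close>

section \<open>Closure properties of total recursive functions\<close>

text \<open>
  The schemes fix the values of a function on argument lists of every length. Since only the lists of
  length \<open>k\<close> matter, computability is made invariant under changes elsewhere, which lets functions be
  written with \<open>hd\<close>, \<open>tl\<close> and other total list operations.
\<close>

definition computable :: "nat \<Rightarrow> (nat list \<Rightarrow> nat) \<Rightarrow> bool" where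
  "computable k f \<longleftrightarrow> (\<exists>F. total_recursive k F \<and> (\<forall>xs. length xs = k \<longrightarrow> F xs = f xs))"

definition decidable :: "nat \<Rightarrow> (nat list \<Rightarrow> bool) \<Rightarrow> bool" where
  "decidable k P \<longleftrightarrow> computable k (\<lambda>xs. of_bool (P xs))"

lemma computable_cong:
  assumes "computable k f" "\<And>xs. length xs = k \<Longrightarrow> f xs = g xs"
  shows "computable k g"
  using assms unfolding computable_def by metis

lemma computable_comp:
  assumes "computable (length gs) f" "\<And>g. g \<in> set gs \<Longrightarrow> computable k g"
  shows "computable k (\<lambda>xs. f (map (\<lambda>g. g xs) gs))"
proof -
  obtain F where F: "total_recursive (length gs) F" "\<And>xs. length xs = length gs \<Longrightarrow> F xs = f xs"
    using assms(1) unfolding computable_def by auto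
  obtain h where h: "\<And>g. g \<in> set gs \<Longrightarrow> total_recursive k (h g)"
    "\<And>g xs. g \<in> set gs \<Longrightarrow> length xs = k \<Longrightarrow> h g xs = g xs"
    using assms(2) unfolding computable_def by metis
  have "total_recursive k (\<lambda>xs. F (map (\<lambda>g. g xs) (map h gs)))"
    using F(1) h(1) by (intro total_recursive.comp) auto
  moreover have "F (map (\<lambda>g. g xs) (map h gs)) = f (map (\<lambda>g. g xs) gs)" if "length xs = k" for xs
  proof -
    have "map (\<lambda>g. g xs) (map h gs) = map (\<lambda>g. g xs) gs" using h(2) that by auto
    moreover have "F (map (\<lambda>g. g xs) (map h gs)) = f (map (\<lambda>g. g xs) (map h gs))"
      by (rule F(2)) simp
    ultimately show ?thesis by (simp only:)
  qed
  ultimately show ?thesis unfolding computable_def by blast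
qed

lemma computable_comp1:
  assumes "computable 1 (\<lambda>xs. f (xs ! 0))" "computable k a"
  shows "computable k (\<lambda>xs. f (a xs))"
  using computable_comp[of "[a]" "\<lambda>xs. f (xs ! 0)" k] assms by simp

lemma computable_comp2:
  assumes "computable 2 (\<lambda>xs. f (xs ! 0) (xs ! 1))" "computable k a" "computable k b"
  shows "computable k (\<lambda>xs. f (a xs) (b xs))"
  using computable_comp[of "[a, b]" "\<lambda>xs. f (xs ! 0) (xs ! 1)" k] assms
  by (auto simp: numeral_2_eq_2)

lemma computable_comp3:
  assumes "computable 3 (\<lambda>xs. f (xs ! 0) (xs ! 1) (xs ! 2))"
    "computable k a" "computable k b" "computable k c"
  shows "computable k (\<lambda>xs. f (a xs) (b xs) (c xs))"
  using computable_comp[of "[a, b, c]" "\<lambda>xs. f (xs ! 0) (xs ! 1) (xs ! 2)" k] assms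
  by (auto simp: numeral_3_eq_3 numeral_2_eq_2)

lemma computable_comp4:
  assumes "computable 4 (\<lambda>xs. f (xs ! 0) (xs ! 1) (xs ! 2) (xs ! 3))"
    "computable k a" "computable k b" "computable k c" "computable k d"
  shows "computable k (\<lambda>xs. f (a xs) (b xs) (c xs) (d xs))"
  using computable_comp[of "[a, b, c, d]" "\<lambda>xs. f (xs ! 0) (xs ! 1) (xs ! 2) (xs ! 3)" k] assms
  by (auto simp: eval_nat_numeral)

lemma computable_nth: "i < k \<Longrightarrow> computable k (\<lambda>xs. xs ! i)"
  unfolding computable_def using total_recursive.proj by blast

lemma funpow_tl: "(tl ^^ j) xs = drop j xs"
  by (induction j arbitrary: xs) (auto simp: drop_Suc tl_drop)

lemma computable_variable:
  assumes "i + j < k"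
  shows "computable k (\<lambda>xs. (tl ^^ j) xs ! i)"
proof (rule computable_cong)
  show "computable k (\<lambda>xs. xs ! (j + i))" using assms by (intro computable_nth) auto
qed (use assms in \<open>auto simp: funpow_tl\<close>)

text \<open>
  Arguments of an outer function become the tail of the argument list below a binder, so a function
  of the outer arguments has to be reread as a function of the longer list.
\<close>

lemma computable_weaken:
  assumes "computable k f"
  shows "computable (j + k) (\<lambda>xs. f ((tl ^^ j) xs))"
proof (rule computable_cong)
  let ?gs = "map (\<lambda>i xs. (tl ^^ j) xs ! i) [0..<k]"
  show "computable (j + k) (\<lambda>xs. f (map (\<lambda>g. g xs) ?gs))"
    using assms by (intro computable_comp) (auto intro: computable_variable)
  show "f (map (\<lambda>g. g xs) ?gs) = f ((tl ^^ j) xs)" if "length xs = j + k" for xs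
  proof -
    show ?thesis using that by (intro arg_cong[where f = f] nth_equalityI) (auto simp: funpow_tl)
  qed
qed

lemma computable_Suc: "computable k a \<Longrightarrow> computable k (\<lambda>xs. Suc (a xs))"
  by (rule computable_comp1) (use total_recursive.succ in \<open>auto simp: computable_def\<close>)

lemma computable_const: "computable k (\<lambda>xs. c)"
proof (induction c)
  case 0
  then show ?case using total_recursive.zero unfolding computable_def by blast
qed (rule computable_Suc)

text \<open>
  Recursion with parameters: the counter and the accumulator are the first two arguments of the step
  function, and the outer arguments follow.
\<close>

lemma computable_rec_nat:
  assumes f: "computable k f" and g: "computable (Suc (Suc k)) (\<lambda>ys. g (hd ys) (hd (tl ys)) (tl (tl ys)))"
    and n: "computable k n"
  shows "computable k (\<lambda>xs. rec_nat (f xs) (\<lambda>y r. g y r xs) (n xs))"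
proof -
  obtain F where F: "total_recursive k F" "\<And>xs. length xs = k \<Longrightarrow> F xs = f xs"
    using f unfolding computable_def by auto
  obtain G where G: "total_recursive (k + 2) G"
    "\<And>ys. length ys = k + 2 \<Longrightarrow> G ys = g (hd ys) (hd (tl ys)) (tl (tl ys))"
    using g unfolding computable_def by auto
  have "computable (k + 1) (\<lambda>xs. rec_nat (f (tl xs)) (\<lambda>y r. g y r (tl xs)) (hd xs))"
    unfolding computable_def
    by (rule exI[of _ "\<lambda>xs. rec_nat (F (tl xs)) (\<lambda>y r. G (y # r # tl xs)) (hd xs)"])
      (use F G total_recursive.prec[OF F(1) G(1)] in auto)
  then have "computable k (\<lambda>xs. (\<lambda>xs. rec_nat (f (tl xs)) (\<lambda>y r. g y r (tl xs)) (hd xs))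
      (map (\<lambda>g. g xs) (n # map (\<lambda>i xs. xs ! i) [0..<k])))"
    using n by (intro computable_comp) (auto intro: computable_nth)
  then show ?thesis
  proof (rule computable_cong)
    show "rec_nat (f (tl (map (\<lambda>g. g xs) (n # map (\<lambda>i xs. xs ! i) [0..<k]))))
       (\<lambda>y r. g y r (tl (map (\<lambda>g. g xs) (n # map (\<lambda>i xs. xs ! i) [0..<k]))))
       (hd (map (\<lambda>g. g xs) (n # map (\<lambda>i xs. xs ! i) [0..<k])))
       = rec_nat (f xs) (\<lambda>y r. g y r xs) (n xs)" if "length xs = k" for xs
    proof -
      have "map (\<lambda>g. g xs) (map (\<lambda>i xs. xs ! i) [0..<k]) = xs"
        using that by (intro nth_equalityI) auto
      then show ?thesis by simp
    qed
  qed
qed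

lemma computable_hd: "computable (Suc k) (\<lambda>xs. hd xs)"
  using computable_nth[of 0 "Suc k"] by (rule computable_cong)
    (auto simp: hd_conv_nth simp flip: length_greater_0_conv)

lemma computable_hd_tl: "computable (Suc (Suc k)) (\<lambda>xs. hd (tl xs))"
  using computable_weaken[OF computable_hd[of k], of 1] by simp

lemma computable_nth_tl: "Suc i < k \<Longrightarrow> computable k (\<lambda>xs. tl xs ! i)"
  using computable_variable[of i 1 k] by simp

lemma computable_nth_tl2: "Suc (Suc i) < k \<Longrightarrow> computable k (\<lambda>xs. tl (tl xs) ! i)"
  using computable_variable[of i 2 k] by (simp add: numeral_2_eq_2)
lemmas computable_vars = computable_hd computable_hd_tl computable_nth
  computable_nth_tl computable_nth_tl2

lemma computable_add:
  assumes "computable k a" "computable k b"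
  shows "computable k (\<lambda>xs. a xs + b xs)"
proof -
  have *: "rec_nat x (\<lambda>y r. Suc r) y = x + y" for x y :: nat by (induction y) auto
  have "computable k (\<lambda>xs. rec_nat (a xs) (\<lambda>y r. Suc r) (b xs))"
    by (rule computable_rec_nat) (intro assms computable_Suc computable_vars)+
  then show ?thesis unfolding * .
qed

lemma computable_pred: "computable k a \<Longrightarrow> computable k (\<lambda>xs. a xs - 1)"
proof -
  assume a: "computable k a"
  have *: "rec_nat 0 (\<lambda>y r. y) y = y - 1" for y :: nat by (cases y) auto
  have "computable k (\<lambda>xs. rec_nat 0 (\<lambda>y r. y) (a xs))"
    by (rule computable_rec_nat) (intro a computable_const computable_vars)+
  then show ?thesis unfolding * .
qed

lemma computable_diff:
  assumes "computable k a" "computable k b"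
  shows "computable k (\<lambda>xs. a xs - b xs)"
proof -
  have *: "rec_nat x (\<lambda>y r. r - 1) y = x - y" for x y :: nat by (induction y) auto
  have "computable k (\<lambda>xs. rec_nat (a xs) (\<lambda>y r. r - 1) (b xs))"
    by (rule computable_rec_nat) (intro assms computable_pred computable_vars)+
  then show ?thesis unfolding * .
qed

text \<open>
  Bounded sums come first because bounded quantifiers and the cardinality of a decidable subset of an
  initial segment are sums of truth values.
\<close>

lemma computable_sum:
  assumes "computable (Suc k) (\<lambda>ys. t (hd ys) (tl ys))" "computable k n"
  shows "computable k (\<lambda>xs. \<Sum>y<n xs. t y xs)"
proof -
  have *: "rec_nat 0 (\<lambda>y r. r + t y xs) n = (\<Sum>y<n. t y xs)" for n xs by (induction n) auto
  have t: "computable (Suc (Suc k)) (\<lambda>ys. t (hd ys) (tl (tl ys)))"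
  proof (rule computable_cong)
    let ?gs = "hd # map (\<lambda>i ys. tl (tl ys) ! i) [0..<k]"
    show "computable (Suc (Suc k)) (\<lambda>ys. (\<lambda>ys. t (hd ys) (tl ys)) (map (\<lambda>g. g ys) ?gs))"
      using assms(1) by (intro computable_comp) (auto intro: computable_vars)
    show "t (hd (map (\<lambda>g. g ys) ?gs)) (tl (map (\<lambda>g. g ys) ?gs)) = t (hd ys) (tl (tl ys))"
      if "length ys = Suc (Suc k)" for ys
    proof -
      have "map (\<lambda>g. g ys) (map (\<lambda>i ys. tl (tl ys) ! i) [0..<k]) = tl (tl ys)"
        using that by (intro nth_equalityI) auto
      then show ?thesis by simp
    qed
  qed
  have "computable k (\<lambda>xs. rec_nat 0 (\<lambda>y r. r + t y xs) (n xs))"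
    by (rule computable_rec_nat) (intro assms t computable_add computable_const computable_vars)+
  then show ?thesis unfolding * .
qed

lemma computable_mult:
  assumes "computable k a" "computable k b"
  shows "computable k (\<lambda>xs. a xs * b xs)"
proof -
  have "computable k (\<lambda>xs. \<Sum>y<b xs. a xs)"
    using computable_weaken[OF assms(1), of 1] assms(2) by (intro computable_sum) auto
  then show ?thesis by (simp add: mult.commute)
qed

lemma decidable_cong:
  assumes "decidable k P" "\<And>xs. length xs = k \<Longrightarrow> P xs \<longleftrightarrow> Q xs"
  shows "decidable k Q"
  using assms unfolding decidable_def by (auto elim: computable_cong)

lemma decidable_comp2:
  assumes "decidable 2 (\<lambda>xs. P (xs ! 0) (xs ! 1))" "computable k a" "computable k b"
  shows "decidable k (\<lambda>xs. P (a xs) (b xs))"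
  using assms computable_comp2[of "\<lambda>x y. of_bool (P x y)"] unfolding decidable_def by blast

lemma decidable_comp3:
  assumes "decidable 3 (\<lambda>xs. P (xs ! 0) (xs ! 1) (xs ! 2))"
    "computable k a" "computable k b" "computable k c"
  shows "decidable k (\<lambda>xs. P (a xs) (b xs) (c xs))"
  using assms computable_comp3[of "\<lambda>x y z. of_bool (P x y z)"] unfolding decidable_def by blast

lemma decidable_comp4:
  assumes "decidable 4 (\<lambda>xs. P (xs ! 0) (xs ! 1) (xs ! 2) (xs ! 3))"
    "computable k a" "computable k b" "computable k c" "computable k d"
  shows "decidable k (\<lambda>xs. P (a xs) (b xs) (c xs) (d xs))"
  using assms computable_comp4[of "\<lambda>x y z w. of_bool (P x y z w)"] unfolding decidable_def by blast

lemma decidable_le: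
  assumes "computable k a" "computable k b"
  shows "decidable k (\<lambda>xs. a xs \<le> b xs)"
proof -
  have *: "1 - (x - y) = of_bool (x \<le> y)" for x y :: nat by auto
  have "computable k (\<lambda>xs. 1 - (a xs - b xs))"
    using assms by (intro computable_diff computable_const)
  then show ?thesis unfolding decidable_def * .
qed

lemma decidable_less: "computable k a \<Longrightarrow> computable k b \<Longrightarrow> decidable k (\<lambda>xs. a xs < b xs)"
  using decidable_le[of k "\<lambda>xs. Suc (a xs)" b] computable_Suc by (simp add: Suc_le_eq)

lemma decidable_conj:
  "decidable k P \<Longrightarrow> decidable k Q \<Longrightarrow> decidable k (\<lambda>xs. P xs \<and> Q xs)"
  unfolding decidable_def of_bool_conj by (rule computable_mult)

lemma decidable_not: "decidable k P \<Longrightarrow> decidable k (\<lambda>xs. \<not> P xs)"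
  unfolding decidable_def of_bool_not_iff
  using computable_diff[OF computable_const[of k 1], of "\<lambda>xs. of_bool (P xs)"]
  by (rule back_subst[of "computable k"]) auto

lemma decidable_disj:
  "decidable k P \<Longrightarrow> decidable k Q \<Longrightarrow> decidable k (\<lambda>xs. P xs \<or> Q xs)"
  using decidable_not[OF decidable_conj[OF decidable_not decidable_not], of k P Q] by simp

lemma decidable_imp:
  "decidable k P \<Longrightarrow> decidable k Q \<Longrightarrow> decidable k (\<lambda>xs. P xs \<longrightarrow> Q xs)"
  unfolding imp_conv_disj by (intro decidable_disj decidable_not)

lemma decidable_eq: "computable k a \<Longrightarrow> computable k b \<Longrightarrow> decidable k (\<lambda>xs. a xs = b xs)"
  unfolding eq_iff[where 'a = nat] by (intro decidable_conj decidable_le)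

lemma computable_of_bool: "decidable k P \<Longrightarrow> computable k (\<lambda>xs. of_bool (P xs))"
  by (simp add: decidable_def)

lemma computable_if:
  assumes "decidable k P" "computable k a" "computable k b"
  shows "computable k (\<lambda>xs. if P xs then a xs else b xs)"
proof -
  have "computable k (\<lambda>xs. of_bool (P xs) * a xs + of_bool (\<not> P xs) * b xs)"
    using assms by (intro computable_add computable_mult computable_of_bool decidable_not)
  then show ?thesis by (rule computable_cong) auto
qed

lemma decidable_all_less:
  assumes "decidable (Suc k) (\<lambda>ys. P (hd ys) (tl ys))" "computable k n"
  shows "decidable k (\<lambda>xs. \<forall>y<n xs. P y xs)"
proof -
  have "decidable k (\<lambda>xs. (\<Sum>y<n xs. of_bool (\<not> P y xs)) = (0::nat))"
    using assms by (intro decidable_eq computable_sum computable_of_bool decidable_not computable_const)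
  moreover have "((\<Sum>y<n xs. of_bool (\<not> P y xs)) = (0::nat)) = (\<forall>y<n xs. P y xs)" for xs
    by (auto simp: sum_eq_0_iff)
  ultimately show ?thesis by simp
qed

lemma decidable_ex_less:
  assumes "decidable (Suc k) (\<lambda>ys. P (hd ys) (tl ys))" "computable k n"
  shows "decidable k (\<lambda>xs. \<exists>y<n xs. P y xs)"
  using decidable_not[OF decidable_all_less[of k "\<lambda>y xs. \<not> P y xs" n]] decidable_not assms by simp

lemma computable_card_less:
  assumes "decidable (Suc k) (\<lambda>ys. P (hd ys) (tl ys))" "computable k n"
  shows "computable k (\<lambda>xs. card {y. y < n xs \<and> P y xs})"
proof -
  have "computable k (\<lambda>xs. \<Sum>y<n xs. of_bool (P y xs))"
    using assms by (intro computable_sum computable_of_bool)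
  moreover have "(\<Sum>y<n xs. of_bool (P y xs)) = card {y. y < n xs \<and> P y xs}" for xs
    by (simp add: sum.If_cases of_bool_def Int_def lessThan_def)
  ultimately show ?thesis by simp
qed

text \<open>
  The existence premise is required for all arguments, meaningful or not; searches below are
  guarded accordingly.
\<close>

lemma computable_Least:
  assumes "decidable (Suc k) (\<lambda>ys. P (hd ys) (tl ys))" "\<And>xs. length xs = k \<Longrightarrow> \<exists>y. P y xs"
  shows "computable k (\<lambda>xs. LEAST y. P y xs)"
proof -
  from decidable_not[OF assms(1)] obtain F where F: "total_recursive (k + 1) F"
    "\<And>ys. length ys = Suc k \<Longrightarrow> F ys = of_bool (\<not> P (hd ys) (tl ys))"
    unfolding decidable_def computable_def by auto
  have *: "(F (y # xs) = 0) = P y xs" if "length xs = k" for y xs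
    using F(2)[of "y # xs"] that by auto
  have "total_recursive k (\<lambda>xs. LEAST y. F (y # xs) = 0)"
    using assms(2) * by (intro total_recursive.minim F(1)) auto
  then show ?thesis using * unfolding computable_def by auto
qed

lemmas computable_intros = computable_vars computable_const computable_add computable_diff
  computable_mult computable_sum computable_if computable_Suc computable_of_bool computable_card_less
  decidable_le decidable_less decidable_eq decidable_conj decidable_disj decidable_not decidable_imp
  decidable_all_less decidable_ex_less

section \<open>Arithmetic on codes of pairs and lists\<close>

lemma computable_triangle: "computable k a \<Longrightarrow> computable k (\<lambda>xs. triangle (a xs))"
proof (rule computable_comp1[where f = triangle])
  have *: "(\<Sum>y<n. Suc y) = triangle n" for n by (induction n) auto
  have "computable 1 (\<lambda>xs. \<Sum>y<xs!0. Suc y)" by (intro computable_intros) auto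
  then show "computable 1 (\<lambda>xs. triangle (xs!0))" unfolding * .
qed

lemma computable_prod_encode:
  "computable k a \<Longrightarrow> computable k b \<Longrightarrow> computable k (\<lambda>xs. prod_encode (a xs, b xs))"
  unfolding prod_encode_def split by (intro computable_intros computable_triangle)

lemma computable_fst_prod_decode: "computable k a \<Longrightarrow> computable k (\<lambda>xs. fst (prod_decode (a xs)))"
proof (rule computable_comp1[where f = "\<lambda>c. fst (prod_decode c)"])
  have *: "(LEAST x. \<exists>y<Suc c. prod_encode (x, y) = c) = fst (prod_decode c)" for c
  proof (rule Least_equality)
    show "\<exists>y<Suc c. prod_encode (fst (prod_decode c), y) = c"
      using le_prod_encode_2[of "snd (prod_decode c)" "fst (prod_decode c)"]
      by (intro exI[of _ "snd (prod_decode c)"]) auto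
  qed auto
  have "computable 1 (\<lambda>xs. LEAST x. \<exists>y<Suc (xs!0). prod_encode (x, y) = xs!0)"
  proof (rule computable_Least)
    show "\<exists>x. \<exists>y<Suc (xs!0). prod_encode (x, y) = xs!0" for xs
      using le_prod_encode_2[of "snd (prod_decode (xs!0))" "fst (prod_decode (xs!0))"]
      by (intro exI[of _ "fst (prod_decode (xs!0))"] exI[of _ "snd (prod_decode (xs!0))"]) auto
  qed (intro computable_intros computable_prod_encode, auto)
  then show "computable 1 (\<lambda>xs. fst (prod_decode (xs!0)))" unfolding * .
qed

lemma computable_snd_prod_decode: "computable k a \<Longrightarrow> computable k (\<lambda>xs. snd (prod_decode (a xs)))"
proof (rule computable_comp1[where f = "\<lambda>c. snd (prod_decode c)"])
  have *: "(LEAST y. prod_encode (fst (prod_decode c), y) = c) = snd (prod_decode c)" for c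
    by (rule Least_equality) (auto, metis eq_iff prod_encode_inverse snd_conv)
  have "computable 1 (\<lambda>xs. LEAST y. prod_encode (fst (prod_decode (xs!0)), y) = xs!0)"
  proof (rule computable_Least)
    show "\<exists>y. prod_encode (fst (prod_decode (xs!0)), y) = xs!0" for xs
      by (intro exI[of _ "snd (prod_decode (xs!0))"]) auto
  qed (intro computable_intros computable_prod_encode computable_fst_prod_decode, auto)
  then show "computable 1 (\<lambda>xs. snd (prod_decode (xs!0)))" unfolding * .
qed

lemma prod_decode_0: "prod_decode 0 = (0, 0)"
  by (simp add: prod_decode_def prod_decode_aux.simps[of 0 0])

text \<open>
  The code of a nonempty list is the successor of the code of its head and tail. At the code \<open>0\<close> of
  the empty list the truncated predecessor decodes to \<open>(0, 0)\<close>, so the empty list is its own tail.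
\<close>

definition code_drop :: "nat \<Rightarrow> nat \<Rightarrow> nat" where
  "code_drop c i = rec_nat c (\<lambda>_ r. snd (prod_decode (r - 1))) i"

lemma list_decode_code_drop: "list_decode (code_drop c i) = drop i (list_decode c)"
proof (induction i)
  case (Suc i)
  have tl: "list_decode (snd (prod_decode (r - 1))) = tl (list_decode r)" for r
    by (cases r) (auto simp: prod_decode_0 split: prod.splits)
  show ?case using Suc tl[of "code_drop c i"] by (simp add: code_drop_def drop_Suc tl_drop)
qed (simp add: code_drop_def)

lemma computable_code_drop:
  assumes "computable k a" "computable k b"
  shows "computable k (\<lambda>xs. code_drop (a xs) (b xs))"
  unfolding code_drop_def
  by (rule computable_rec_nat) (intro computable_intros computable_snd_prod_decode assms)+

lemma computable_nth_default:
  assumes "computable k a" "computable k b"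
  shows "computable k (\<lambda>xs. nth_default 0 (list_decode (a xs)) (b xs))"
proof -
  have *: "fst (prod_decode (code_drop c i - 1)) = nth_default 0 (list_decode c) i" for c i
  proof (cases "code_drop c i")
    case 0
    then have "drop i (list_decode c) = []" using list_decode_code_drop[of c i] by simp
    then show ?thesis using 0 by (simp add: nth_default_def prod_decode_0)
  next
    case (Suc d)
    then have "drop i (list_decode c) = fst (prod_decode d) # list_decode (snd (prod_decode d))"
      using list_decode_code_drop[of c i] by (simp split: prod.splits)
    then have "i < length (list_decode c)" "list_decode c ! i = fst (prod_decode d)"
       apply (metis drop_eq_Nil2 leI list.distinct(1))
      by (metis \<open>drop i (list_decode c) = _\<close> drop_eq_Nil2 hd_drop_conv_nth leI list.distinct(1) list.sel(1))
    then show ?thesis using Suc by (simp add: nth_default_def)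
  qed
  have "computable k (\<lambda>xs. fst (prod_decode (code_drop (a xs) (b xs) - 1)))"
    by (intro computable_fst_prod_decode computable_code_drop computable_intros assms)
  then show ?thesis unfolding * .
qed

lemma computable_length: "computable k a \<Longrightarrow> computable k (\<lambda>xs. length (list_decode (a xs)))"
proof (rule computable_comp1[where f = "\<lambda>c. length (list_decode c)"])
  have zero: "(code_drop c i = 0) = (length (list_decode c) \<le> i)" for c i
    by (metis drop_eq_Nil2 list_decode_code_drop list_decode_inverse list_encode.simps(1) list_decode.simps(1))
  have *: "(LEAST i. code_drop c i = 0) = length (list_decode c)" for c
    unfolding zero by (rule Least_equality) auto
  have "computable 1 (\<lambda>xs. LEAST i. code_drop (xs!0) i = 0)"
  proof (rule computable_Least)
    show "\<exists>i. code_drop (xs!0) i = 0" for xs using zero by auto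
  qed (intro computable_intros computable_code_drop, auto)
  then show "computable 1 (\<lambda>xs. length (list_decode (xs!0)))" unfolding * .
qed

section \<open>Matching finite sets of numbers by rank\<close>

definition rank :: "nat set \<Rightarrow> nat \<Rightarrow> nat" where
  "rank X x = card {y. y < x \<and> y \<in> X}"

text \<open>
  For arguments outside \<open>X\<close> the condition is void, which makes the search total.
\<close>

definition rank_match :: "nat set \<Rightarrow> nat set \<Rightarrow> nat \<Rightarrow> nat" where
  "rank_match X Y x = (LEAST y. x \<in> X \<longrightarrow> y \<in> Y \<and> rank Y y = rank X x)"

text \<open>
  The rank is strictly increasing on \<open>X\<close> and smaller than the cardinality, so counting makes it a
  bijection onto an initial segment.
\<close>

lemma bij_betw_rank:
  assumes "finite X"
  shows "bij_betw (rank X) X {..<card X}"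
proof -
  have less: "rank X x < rank X y" if "x \<in> X" "x < y" for x y
    unfolding rank_def using that by (intro psubset_card_mono) auto
  have "inj_on (rank X) X"
    by (rule inj_onI) (metis less less_irrefl linorder_neqE_nat)
  moreover have "rank X ` X \<subseteq> {..<card X}"
    unfolding rank_def using assms by (auto intro!: psubset_card_mono)
  ultimately show ?thesis
    by (simp add: bij_betw_def card_image card_subset_eq)
qed

lemma rank_match:
  assumes "finite X" "finite Y" "card X = card Y" "x \<in> X"
  shows "rank_match X Y x \<in> Y" "rank Y (rank_match X Y x) = rank X x"
proof -
  have "rank X x \<in> rank Y ` Y"
    using bij_betw_rank[OF assms(1)] bij_betw_rank[OF assms(2)] assms(3,4) by (auto simp: bij_betw_def)
  then have "\<exists>y. x \<in> X \<longrightarrow> y \<in> Y \<and> rank Y y = rank X x" by force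
  from LeastI_ex[OF this] show "rank_match X Y x \<in> Y" "rank Y (rank_match X Y x) = rank X x"
    using assms(4) unfolding rank_match_def by auto
qed

lemma rank_match_inverse:
  assumes "finite X" "finite Y" "card X = card Y" "x \<in> X"
  shows "rank_match Y X (rank_match X Y x) = x"
proof -
  let ?y = "rank_match X Y x"
  have "rank_match Y X ?y \<in> X" "rank X (rank_match Y X ?y) = rank X x"
    using rank_match[OF assms] rank_match[of Y X ?y] assms by auto
  then show ?thesis
    using bij_betw_rank[OF assms(1)] assms(4) by (auto simp: bij_betw_def dest: inj_onD)
qed

lemma bij_betw_rank_match:
  assumes "finite X" "finite Y" "card X = card Y"
  shows "bij_betw (rank_match X Y) X Y"
proof (rule bij_betwI[where g = "rank_match Y X"])
  show "rank_match X Y \<in> X \<rightarrow> Y" "rank_match Y X \<in> Y \<rightarrow> X"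
    using rank_match(1) assms by simp_all
qed (use rank_match_inverse assms in simp_all)

lemma computable_rank:
  assumes "decidable 4 (\<lambda>xs. xs!3 \<in> X (xs!0) (xs!1) (xs!2))"
  shows "computable 4 (\<lambda>xs. rank (X (xs!0) (xs!1) (xs!2)) (xs!3))"
  unfolding rank_def
  by (intro computable_card_less decidable_comp4[OF assms] computable_intros) auto

text \<open>
  Ranks are computed by a bounded count, matching codes by an unbounded search. The search ends for all
  arguments because corresponding sets have the same size.
\<close>

lemma computable_rank_match:
  assumes X: "decidable 4 (\<lambda>xs. xs!3 \<in> X (xs!0) (xs!1) (xs!2))"
    and Y: "decidable 4 (\<lambda>xs. xs!3 \<in> Y (xs!0) (xs!1) (xs!2))"
    and fin: "\<And>m n e. finite (X m n e)" "\<And>m n e. finite (Y m n e)"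
    and card: "\<And>m n e. card (X m n e) = card (Y m n e)"
  shows "computable 4 (\<lambda>xs. rank_match (X (xs!0) (xs!1) (xs!2)) (Y (xs!0) (xs!1) (xs!2)) (xs!3))"
  unfolding rank_match_def
proof (rule computable_Least)
  show "\<exists>y. xs!3 \<in> X (xs!0) (xs!1) (xs!2) \<longrightarrow> y \<in> Y (xs!0) (xs!1) (xs!2) \<and>
      rank (Y (xs!0) (xs!1) (xs!2)) y = rank (X (xs!0) (xs!1) (xs!2)) (xs!3)" for xs
    using rank_match[OF fin card] by blast
qed (intro decidable_imp decidable_conj decidable_eq decidable_comp4[OF X] decidable_comp4[OF Y]
    computable_comp4[OF computable_rank[OF X]] computable_comp4[OF computable_rank[OF Y]]
    computable_intros; simp)

section \<open>Zigzag words\<close>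

text \<open>
  The admissible values at \<open>x\<^sub>i\<^sub>+\<^sub>1\<close> when the value at \<open>x\<^sub>i\<close> is \<open>j\<close>.
\<close>

fun next_values :: "nat \<Rightarrow> step_sign \<Rightarrow> nat \<Rightarrow> nat set" where
  "next_values m Plus j = {1..j}"
| "next_values m Minus j = {j..m}"

text \<open>
  The number of order-preserving maps into \<open>[m]\<close> whose value at the first element is \<open>j\<close>.
\<close>

fun zigzag_count :: "nat \<Rightarrow> step_sign list \<Rightarrow> nat \<Rightarrow> nat" where
  "zigzag_count m [] j = 1"
| "zigzag_count m (e # es) j = (\<Sum>i\<in>next_values m e j. zigzag_count m es i)"

definition zigzag_words :: "nat \<Rightarrow> step_sign list \<Rightarrow> nat list set" where
  "zigzag_words m es = {fs. length fs = Suc (length es) \<and> set fs \<subseteq> {1..m} \<and>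
     (\<forall>i<length es. fs ! Suc i \<in> next_values m (es ! i) (fs ! i))}"

lemma finite_zigzag_lists: "finite (zigzag_words m es)"
  by (rule finite_subset[OF _ finite_lists_length_eq[of "{1..m}" "Suc (length es)"]])
    (auto simp: zigzag_words_def)

lemma card_zigzag_lists_hd:
  "j \<in> {1..m} \<Longrightarrow> card {fs \<in> zigzag_words m es. hd fs = j} = zigzag_count m es j"
proof (induction es arbitrary: j)
  case Nil
  then have "{fs \<in> zigzag_words m []. hd fs = j} = {[j]}"
    by (auto simp: zigzag_words_def length_Suc_conv)
  then show ?case by simp
next
  case (Cons e es)
  have up: "next_values m e j \<subseteq> {1..m}" using Cons.prems by (cases e) auto
  have "{fs \<in> zigzag_words m (e # es). hd fs = j} =
     (\<Union>i\<in>next_values m e j. (#) j ` {fs \<in> zigzag_words m es. hd fs = i})" (is "?L = ?R")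
  proof (intro equalityI subsetI)
    fix fs assume "fs \<in> ?L"
    moreover from this obtain y ys where fs: "fs = j # y # ys"
      by (auto simp: zigzag_words_def length_Suc_conv)
    ultimately have "y \<in> next_values m e j" "y # ys \<in> zigzag_words m es"
      by (auto simp: zigzag_words_def All_less_Suc2)
    then show "fs \<in> ?R" by (intro UN_I[of y]) (auto simp: fs)
  next
    fix fs assume "fs \<in> ?R"
    then obtain i gs where "i \<in> next_values m e j" "fs = j # gs" "gs \<in> zigzag_words m es" "hd gs = i"
      by auto
    moreover from this obtain ys where "gs = i # ys" by (cases gs) (auto simp: zigzag_words_def)
    ultimately show "fs \<in> ?L" using Cons.prems
      by (auto simp: zigzag_words_def All_less_Suc2 nth_Cons')
  qed
  also have "card \<dots> = (\<Sum>i\<in>next_values m e j. card ((#) j ` {fs \<in> zigzag_words m es. hd fs = i}))"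
    using finite_zigzag_lists up by (intro card_UN_disjoint) (auto intro: finite_subset)
  also have "\<dots> = (\<Sum>i\<in>next_values m e j. zigzag_count m es i)"
    using Cons.IH up by (intro sum.cong) (auto simp: card_image)
  finally show ?case by simp
qed

lemma card_zigzag_lists: "card (zigzag_words m es) = (\<Sum>j=1..m. zigzag_count m es j)"
proof -
  have "zigzag_words m es = (\<Union>j\<in>{1..m}. {fs \<in> zigzag_words m es. hd fs = j})"
  proof -
    have "hd fs \<in> {1..m}" if "fs \<in> zigzag_words m es" for fs
      using that hd_in_set[of fs] by (fastforce simp: zigzag_words_def)
    then show ?thesis by blast
  qed
  also have "card \<dots> = (\<Sum>j=1..m. card {fs \<in> zigzag_words m es. hd fs = j})"
    using finite_zigzag_lists by (intro card_UN_disjoint) auto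
  finally show ?thesis using card_zigzag_lists_hd by simp
qed

section \<open>Records of permutation words\<close>

fun sign_rel :: "step_sign \<Rightarrow> nat \<Rightarrow> nat \<Rightarrow> bool" where
  "sign_rel Plus x y \<longleftrightarrow> x > y"
| "sign_rel Minus x y \<longleftrightarrow> x < y"

text \<open>
  The values at the greedy records from left to right. The head is the record found last by the
  right-to-left scan, against which a further entry on the left has to be compared.
\<close>

fun record_values :: "step_sign list \<Rightarrow> nat list \<Rightarrow> nat list" where
  "record_values (e # es) (x # xs) =
     (let r = record_values es xs in if sign_rel e x (hd r) then x # r else r)"
| "record_values _ xs = xs"

definition perm_words :: "nat \<Rightarrow> nat list set" where
  "perm_words n = {xs. distinct xs \<and> set xs = {1..n}}"

lemma length_perm_words: "xs \<in> perm_words n \<Longrightarrow> length xs = n"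
  by (auto simp: perm_words_def dest: distinct_card)

lemma finite_perm_words: "finite (perm_words n)"
  by (rule finite_subset[OF _ finite_lists_length_eq[of "{1..n}" n]])
    (auto simp: length_perm_words, auto simp: perm_words_def)

text \<open>
  Makes room for the value \<open>u\<close>: the increasing bijection onto the numbers different from \<open>u\<close>.
\<close>

definition shift :: "nat \<Rightarrow> nat \<Rightarrow> nat" where
  "shift u x = (if x < u then x else Suc x)"

lemma strict_mono_shift: "strict_mono (shift u)"
  by (rule strict_monoI) (auto simp: shift_def)

lemma sign_rel_strict_mono: "strict_mono g \<Longrightarrow> sign_rel e (g x) (g y) \<longleftrightarrow> sign_rel e x y"
  by (cases e) (auto simp: strict_mono_less)

lemma record_values_nonempty:
  "length xs = Suc (length es) \<Longrightarrow> record_values es xs \<noteq> [] \<and> set (record_values es xs) \<subseteq> set xs"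
proof (induction es arbitrary: xs)
  case (Cons e es)
  then obtain x ys where "xs = x # ys" "length ys = Suc (length es)" by (cases xs) auto
  then show ?case using Cons.IH[of ys] by (auto simp: Let_def)
qed auto

text \<open>
  Records depend on the relative order of the entries only.
\<close>

lemma record_values_strict_mono:
  assumes "strict_mono g" "length xs = Suc (length es)"
  shows "record_values es (map g xs) = map g (record_values es xs)"
  using assms(2)
proof (induction es arbitrary: xs)
  case (Cons e es)
  then obtain x ys where *: "xs = x # ys" "length ys = Suc (length es)" by (cases xs) auto
  then show ?case using Cons.IH[of ys] record_values_nonempty[OF *(2)]
    by (auto simp: Let_def list.map_sel sign_rel_strict_mono[OF assms(1)])
qed auto

text \<open>
  A permutation of size \<open>n + 1\<close> is determined by its first entry and the relative order of the others.
\<close>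

lemma perm_words_prepend:
  "bij_betw (\<lambda>(u, xs). u # map (shift u) xs) ({1..Suc n} \<times> perm_words n) (perm_words (Suc n))"
proof (rule bij_betwI[where g = "\<lambda>ys. (hd ys, map (\<lambda>y. if y < hd ys then y else y - 1) (tl ys))"])
  show "(\<lambda>(u, xs). u # map (shift u) xs) \<in> {1..Suc n} \<times> perm_words n \<rightarrow> perm_words (Suc n)"
  proof (clarsimp simp: perm_words_def)
    fix u and xs :: "nat list" assume *: "distinct xs" "set xs = {Suc 0..n}" "Suc 0 \<le> u" "u \<le> Suc n"
    have "insert u (shift u ` {Suc 0..n}) = {Suc 0..Suc n}"
    proof (intro equalityI subsetI)
      fix y assume y: "y \<in> {Suc 0..Suc n}"
      consider "y < u" | "y = u" | "u < y" by linarith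
      then show "y \<in> insert u (shift u ` {Suc 0..n})"
      proof cases
        case 1
        then have "y = shift u y" "y \<in> {Suc 0..n}" using y * by (auto simp: shift_def)
        then show ?thesis by blast
      next
        case 3
        then have "y = shift u (y - 1)" "y - 1 \<in> {Suc 0..n}" using y *(3,4) by (auto simp: shift_def)
        then show ?thesis by blast
      qed simp
    qed (use * in \<open>auto simp: shift_def split: if_splits\<close>)
    then show "u \<notin> shift u ` {Suc 0..n} \<and> distinct (map (shift u) xs) \<and>
        insert u (shift u ` {Suc 0..n}) = {Suc 0..Suc n}"
      using * strict_mono_shift[of u]
      by (auto simp: distinct_map strict_mono_eq inj_on_def) (auto simp: shift_def split: if_splits)
  qed
  show "(\<lambda>ys. (hd ys, map (\<lambda>y. if y < hd ys then y else y - 1) (tl ys)))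
      \<in> perm_words (Suc n) \<rightarrow> {1..Suc n} \<times> perm_words n"
  proof (rule funcsetI)
    fix ys assume "ys \<in> perm_words (Suc n)"
    moreover from this obtain u zs where ys: "ys = u # zs"
      by (cases ys) (auto dest: length_perm_words)
    ultimately have *: "distinct zs" "u \<notin> set zs" "insert u (set zs) = {1..Suc n}"
      by (auto simp: perm_words_def)
    then have set: "set zs = {1..Suc n} - {u}" "u \<in> {1..Suc n}" by blast+
    let ?g = "\<lambda>y. if y < u then y else y - 1"
    have "?g ` set zs = {1..n}"
    proof (intro equalityI subsetI)
      fix x assume x: "x \<in> {1..n}"
      then have "x = ?g (shift u x)" "shift u x \<in> set zs" unfolding set(1) by (auto simp: shift_def)
      then show "x \<in> ?g ` set zs" by blast
    next
      fix x assume "x \<in> ?g ` set zs"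
      then obtain y where "y \<in> {1..Suc n} - {u}" "x = ?g y" unfolding set(1) by blast
      then show "x \<in> {1..n}" using set(2) by (cases "y < u") auto
    qed
    moreover have "inj_on ?g (set zs)"
    proof (rule inj_onI)
      fix x y assume "x \<in> set zs" "y \<in> set zs" and eq: "?g x = ?g y"
      then have "x \<noteq> u" "y \<noteq> u" using *(2) by auto
      then show "x = y" using eq by (cases "x < u"; cases "y < u") auto
    qed
    ultimately show "(hd ys, map (\<lambda>y. if y < hd ys then y else y - 1) (tl ys)) \<in> {1..Suc n} \<times> perm_words n"
      using * set(2) by (simp add: ys perm_words_def distinct_map)
  qed
  show "(\<lambda>ys. (hd ys, map (\<lambda>y. if y < hd ys then y else y - 1) (tl ys)))
      ((\<lambda>(u, xs). u # map (shift u) xs) p) = p" if "p \<in> {1..Suc n} \<times> perm_words n" for p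
    using that by (cases p) (auto simp: shift_def intro!: map_idI)
  show "(\<lambda>(u, xs). u # map (shift u) xs)
      ((\<lambda>ys. (hd ys, map (\<lambda>y. if y < hd ys then y else y - 1) (tl ys))) ys) = ys"
    if mem: "ys \<in> perm_words (Suc n)" for ys
  proof -
    obtain u zs where ys: "ys = u # zs" using length_perm_words[OF mem] by (cases ys) auto
    then have "u \<notin> set zs" using mem by (simp add: perm_words_def)
    then have "shift u (if y < u then y else y - 1) = y" if "y \<in> set zs" for y
      using that by (cases "y < u"; cases "y = u") (auto simp: shift_def)
    then show ?thesis by (auto simp: ys intro!: map_idI)
  qed
qed

section \<open>The beta-binomial kernel\<close>

text \<open>
  The number of lattice paths from \<open>(0, 0)\<close> to \<open>(s - 1, m - 1)\<close> through \<open>(v - 1, j - 1)\<close>.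
\<close>

definition kernel :: "nat \<Rightarrow> nat \<Rightarrow> nat \<Rightarrow> nat \<Rightarrow> nat" where
  "kernel m s j v = ((v - 1) + (j - 1) choose (j - 1)) * ((s - v) + (m - j) choose (m - j))"

text \<open>
  Turning the paths by half a turn; this exchanges the roles of the two signs.
\<close>

lemma kernel_reflect:
  assumes "1 \<le> j" "j \<le> m" "1 \<le> v" "v \<le> s"
  shows "kernel m s (Suc m - j) (Suc s - v) = kernel m s j v"
proof -
  have "Suc s - v - 1 = s - v" "Suc m - j - 1 = m - j" "s - (Suc s - v) = v - 1" "m - (Suc m - j) = j - 1"
    using assms by auto
  then show ?thesis by (simp add: kernel_def mult.commute)
qed

text \<open>
  The discrete form of a fact on beta densities: the distribution functions of two consecutive order
  statistics differ by a single binomial probability. Sums of \<open>kernel\<close> over an upper segment have no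
  closed form, but by this lemma their increments in \<open>i\<close> have one.
\<close>

lemma kernel_record_difference:
  fixes a p q b :: nat
  assumes "1 \<le> i" "i < m" "1 \<le> v" "v \<le> Suc s"
  shows "(\<Sum>u=v..s. kernel m s (Suc i) u) =
     (\<Sum>u=v..s. kernel m s i u) + ((v - 1) + i - 1 choose i) * ((Suc s - v) + (m - i) - 1 choose (m - i))"
  using assms(4,3)
proof (induction v rule: inc_induct)
  case base
  obtain k where "m - i = Suc k" using assms by (metis Suc_diff_Suc)
  then show ?case by simp
next
  case (step v)
  then have v: "1 \<le> v" "v \<le> s" by auto
  obtain k where k: "m - i = Suc k" "m - Suc i = k" using assms by (metis Suc_diff_Suc)
  obtain w where w: "v = Suc w" using v by (cases v) auto
  obtain l where l: "i = Suc l" using assms by (cases i) auto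
  obtain d where d: "s - v = d" "Suc s - v = Suc d" "Suc s - Suc v = d" using v by auto
  have eq: "{v..s} = insert v {Suc v..s}" using v by auto
  have "(\<Sum>u=Suc v..s. kernel m s (Suc i) u) =
     (\<Sum>u=Suc v..s. kernel m s i u) + (v + i - 1 choose i) * (d + (m - i) - 1 choose (m - i))"
    using step.IH d by simp
  moreover have "kernel m s (Suc i) v + (v + i - 1 choose i) * (d + (m - i) - 1 choose (m - i)) =
     kernel m s i v + ((v - 1) + i - 1 choose i) * (Suc d + (m - i) - 1 choose (m - i))"
    unfolding kernel_def k unfolding w l d[unfolded w] by (simp add: algebra_simps)
  ultimately show ?case unfolding eq using d by simp
qed

text \<open>
  Induction on \<open>i\<close>. The increment of the left-hand side has a closed form by
  \<open>kernel_record_difference\<close>, and absorption identities turn it into the summand of the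
  right-hand side; the start \<open>i = 1\<close> is a hockey-stick sum.
\<close>

lemma kernel_record_step_Plus:
  assumes "1 \<le> v" "v \<le> s" "1 \<le> i" "i \<le> m"
  shows "m * (\<Sum>u=Suc v..Suc s. kernel m (Suc s) i u) + v * kernel m (Suc s) i (Suc v) =
     (s + m) * (\<Sum>j=1..i. kernel m s j v)"
  using assms(3,4)
proof (induction i rule: dec_induct)
  case base
  obtain k where k: "m = Suc k" using assms by (cases m) auto
  have "(\<Sum>u=Suc v..Suc s. kernel m (Suc s) 1 u) = (\<Sum>u=Suc v..Suc s. (Suc s - u) + k choose k)"
    by (simp add: kernel_def k)
  also have "\<dots> = (\<Sum>d\<le>s - v. (d + k choose k))"
    by (rule sum.reindex_bij_witness[of _ "\<lambda>d. Suc s - d" "\<lambda>u. Suc s - u"]) (use assms in auto)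
  also have "\<dots> = (\<Sum>d\<le>s - v. (k + d choose d))"
    by (intro sum.cong refl, subst binomial_symmetric) (auto simp: add.commute)
  also have "\<dots> = (Suc (k + (s - v)) choose (s - v))"
    by (rule sum_choose_lower)
  also have "\<dots> = (Suc (s - v + k) choose Suc k)"
    by (subst binomial_symmetric) (auto simp: add.commute)
  finally have "m * (\<Sum>u=Suc v..Suc s. kernel m (Suc s) 1 u) = Suc (s - v + k) * (s - v + k choose k)"
    unfolding k by (metis Suc_times_binomial)
  moreover have "kernel m (Suc s) 1 (Suc v) = (s - v + k choose k)" "kernel m s 1 v = (s - v + k choose k)"
    by (auto simp: kernel_def k)
  moreover obtain d where "s = v + d" using assms by (metis le_add_diff_inverse)
  ultimately show ?case unfolding k by (simp add: algebra_simps del: sum.cl_ivl_Suc)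
next
  case (step i)
  obtain k where k: "m - i = Suc k" "m - Suc i = k" "m = Suc k + i"
    using step by (metis Suc_diff_Suc le_add_diff_inverse2 less_imp_le Suc_le_lessD)
  obtain w where w: "v = Suc w" using assms by (cases v) auto
  obtain l where l: "i = Suc l" using step by (cases i) auto
  obtain d where d: "s - v = d" "s = v + d" using assms by (metis le_add_diff_inverse)
  let ?X = "v + i - 1 choose i" and ?Y = "d + k choose k" and ?Z = "Suc d + k choose Suc k"
  have diff: "(\<Sum>u=Suc v..Suc s. kernel m (Suc s) (Suc i) u) =
     (\<Sum>u=Suc v..Suc s. kernel m (Suc s) i u) + ?X * ?Z"
    using kernel_record_difference[of i m "Suc v" "Suc s"] step assms k d by (simp add: Suc_diff_le)
  have K: "kernel m (Suc s) (Suc i) (Suc v) = (v + i choose i) * ?Y"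
    "kernel m (Suc s) i (Suc v) = (v + i - 1 choose (i - 1)) * ?Z"
    "kernel m s (Suc i) v = ?X * ?Y"
    using k d by (auto simp: kernel_def l w)
  have X: "v * (v + i choose i) = (v + i) * ?X"
    using binomial_absorb_comp[of "v + i" i] by simp
  have X': "v * (v + i - 1 choose (i - 1)) = i * ?X"
    using binomial_absorb_comp[of "w + i" l] binomial_absorption[of l "w + i"] unfolding w l
    by (simp add: algebra_simps)
  have Z: "Suc k * ?Z = (Suc d + k) * ?Y"
    using Suc_times_binomial[of k "d + k"] by simp
  have "v * kernel m (Suc s) (Suc i) (Suc v) + m * (?X * ?Z)  =
      v * kernel m (Suc s) i (Suc v) + (s + m) * kernel m s (Suc i) v"
  proof -
    have "v * kernel m (Suc s) (Suc i) (Suc v) = (v + i) * (?X * ?Y)"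
      unfolding K by (metis X mult.assoc)
    moreover have "v * kernel m (Suc s) i (Suc v) = i * (?X * ?Z)"
      unfolding K by (metis X' mult.assoc)
    moreover have "m * (?X * ?Z) = i * (?X * ?Z) + (Suc d + k) * (?X * ?Y)"
    proof -
      have "m * (?X * ?Z) = i * (?X * ?Z) + ?X * (Suc k * ?Z)" by (simp add: k(3) algebra_simps)
      then show ?thesis unfolding Z by (simp only: mult_ac)
    qed
    moreover have "s + m = (v + i) + (Suc d + k)" using k d by simp
    ultimately show ?thesis unfolding K(3) by (simp only: distrib_right)
  qed
  then show ?case using step unfolding diff by (simp add: algebra_simps)
qed

lemma kernel_record_step_Minus:
  assumes "1 \<le> v" "v \<le> s" "1 \<le> i" "i \<le> m"
  shows "m * (\<Sum>u=1..v. kernel m (Suc s) i u) + (Suc s - v) * kernel m (Suc s) i v =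
     (s + m) * (\<Sum>j=i..m. kernel m s j v)"
proof -
  have "(\<Sum>u=1..v. kernel m (Suc s) i u) = (\<Sum>u=Suc (Suc s - v)..Suc s. kernel m (Suc s) (Suc m - i) u)"
    by (rule sum.reindex_bij_witness[of _ "\<lambda>u. Suc (Suc s) - u" "\<lambda>u. Suc (Suc s) - u"])
      (use assms kernel_reflect[of i m _ "Suc s"] in auto)
  moreover have "(\<Sum>j=i..m. kernel m s j v) = (\<Sum>j=1..Suc m - i. kernel m s j (Suc s - v))"
    by (rule sum.reindex_bij_witness[of _ "\<lambda>u. Suc m - u" "\<lambda>u. Suc m - u"])
      (use assms kernel_reflect[of _ m v s] in auto)
  moreover have "kernel m (Suc s) i v = kernel m (Suc s) (Suc m - i) (Suc (Suc s - v))"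
    using kernel_reflect[of i m v "Suc s"] assms by (simp add: Suc_diff_le)
  ultimately show ?thesis
    using kernel_record_step_Plus[of "Suc s - v" s "Suc m - i" m] assms by (simp del: sum.cl_ivl_Suc)
qed

text \<open>
  The case \<open>i = m\<close> of \<open>kernel_record_step_Plus\<close> has the sum over all \<open>j\<close> on its right-hand side, while
  \<open>kernel\<close> degenerates to a single binomial coefficient on the left.
\<close>

lemma kernel_sum:
  assumes "1 \<le> v" "v \<le> s" "1 \<le> m"
  shows "(\<Sum>j=1..m. kernel m s j v) = (s + m - 1 choose (m - 1))"
proof -
  have step: "m * (\<Sum>u=Suc v..Suc s. kernel m (Suc s) m u) + v * kernel m (Suc s) m (Suc v) =
     (s + m) * (\<Sum>j=1..m. kernel m s j v)"
    using assms by (intro kernel_record_step_Plus) auto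
  obtain k where k: "m = Suc k" using assms by (cases m) auto
  have *: "(\<Sum>u=Suc v..Suc t. (u - 1) + k choose k) + (v + k choose Suc k) = (Suc t + k choose Suc k)"
    if "v \<le> t" for t
    using that by (induction t rule: dec_induct) (auto simp: algebra_simps)
  have "(\<Sum>u=Suc v..Suc s. kernel m (Suc s) m u) + (v + k choose Suc k) = (Suc s + k choose Suc k)"
    using *[OF assms(2)] by (simp add: kernel_def k)
  moreover have "m * (v + k choose Suc k) = v * kernel m (Suc s) m (Suc v)"
    unfolding k using binomial_absorption[of k "v + k"] binomial_absorb_comp[of "v + k" k]
    by (simp add: kernel_def)
  moreover have "m * (Suc s + k choose Suc k) = (s + m) * (s + k choose k)"
    using Suc_times_binomial[of k "s + k"] by (simp add: k)
  ultimately have "(s + m) * (\<Sum>j=1..m. kernel m s j v) = (s + m) * (s + k choose k)"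
    unfolding step[symmetric] by (metis distrib_left)
  then have "(\<Sum>j=1..m. kernel m s j v) = (s + k choose k)"
    using assms by (subst (asm) mult_cancel1) simp
  then show ?thesis by (simp add: k)
qed

text \<open>
  On the left the word has been extended by a first entry \<open>u\<close>, on the right the poset by a first
  element of value \<open>i\<close>: the kernel turns the one step into the other, up to the factor \<open>s + m\<close> that
  is independent of \<open>v\<close>.
\<close>

lemma kernel_record_step:
  assumes "1 \<le> v" "v \<le> s" "1 \<le> i" "i \<le> m"
  shows "(\<Sum>u=1..Suc s. if sign_rel e u (shift u v) then m * kernel m (Suc s) i u
       else kernel m (Suc s) i (shift u v)) = (s + m) * (\<Sum>j\<in>next_values m e i. kernel m s j v)"
proof -
  have split: "(\<Sum>u=1..Suc s. h u) = (\<Sum>u=1..v. h u) + (\<Sum>u=Suc v..Suc s. h u)" for h :: "nat \<Rightarrow> nat"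
    using assms sum.ub_add_nat[of 1 v h "Suc s - v"] by simp
  show ?thesis
  proof (cases e)
    case Plus
    have "(\<Sum>u=1..v. if sign_rel e u (shift u v) then m * kernel m (Suc s) i u
       else kernel m (Suc s) i (shift u v)) = (\<Sum>u=1..v. kernel m (Suc s) i (Suc v))"
      by (intro sum.cong) (auto simp: shift_def Plus)
    moreover have "(\<Sum>u=Suc v..Suc s. if sign_rel e u (shift u v) then m * kernel m (Suc s) i u
       else kernel m (Suc s) i (shift u v)) = m * (\<Sum>u=Suc v..Suc s. kernel m (Suc s) i u)"
      unfolding sum_distrib_left by (intro sum.cong) (auto simp: shift_def Plus)
    ultimately show ?thesis
      unfolding split using kernel_record_step_Plus[OF assms] by (simp add: Plus)
  next
    case Minus
    have "(\<Sum>u=1..v. if sign_rel e u (shift u v) then m * kernel m (Suc s) i u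
       else kernel m (Suc s) i (shift u v)) = m * (\<Sum>u=1..v. kernel m (Suc s) i u)"
      unfolding sum_distrib_left by (intro sum.cong) (auto simp: shift_def Minus)
    moreover have "(\<Sum>u=Suc v..Suc s. if sign_rel e u (shift u v) then m * kernel m (Suc s) i u
       else kernel m (Suc s) i (shift u v)) = (\<Sum>u=Suc v..Suc s. kernel m (Suc s) i v)"
      by (intro sum.cong) (auto simp: shift_def Minus)
    ultimately show ?thesis
      unfolding split using kernel_record_step_Minus[OF assms] by (simp add: Minus)
  qed
qed

section \<open>The record generating function\<close>

text \<open>
  Grouping the permutations of size \<open>s + 1\<close> by the relative order of all entries but the first, the
  inner sum over the first entry is \<open>kernel_record_step\<close>; the factors \<open>s + m\<close> accumulate to the
  rising factorial.
\<close>

lemma weighted_record_sum: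
  assumes "i \<in> {1..m}"
  shows "(\<Sum>xs\<in>perm_words (Suc (length es)). m ^ length (record_values es xs) *
      kernel m (Suc (length es)) i (hd (record_values es xs))) =
    pochhammer m (Suc (length es)) * zigzag_count m es i"
  using assms
proof (induction es arbitrary: i)
  case Nil
  have "xs = [1]" if "distinct xs" "set xs = {1}" for xs :: "nat list"
    using that by (cases xs) (auto, metis distinct.simps(2) empty_set insertI1 list.exhaust list.set(2)
        singletonD subset_singletonD insert_not_empty)
  then have "perm_words (Suc 0) = {[1]}"
    by (auto simp: perm_words_def)
  then show ?case by (simp add: kernel_def)
next
  case (Cons e es)
  define s where "s = Suc (length es)"
  define r where "r = record_values es"
  have r: "r xs \<noteq> []" "hd (r xs) \<in> {1..s}" "length xs = Suc (length es)" if "xs \<in> perm_words s" for xs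
  proof -
    show l: "length xs = Suc (length es)" using length_perm_words[OF that] by (simp add: s_def)
    show "r xs \<noteq> []" using record_values_nonempty[OF l] by (simp add: r_def)
    then have "hd (r xs) \<in> set xs" using record_values_nonempty[OF l] hd_in_set by (auto simp: r_def)
    then show "hd (r xs) \<in> {1..s}" using that by (simp add: perm_words_def)
  qed
  have up: "next_values m e i \<subseteq> {1..m}" using Cons.prems by (cases e) auto
  let ?R = "record_values (e # es)"
  \<comment> \<open>a word of length \<open>s + 1\<close> is a first entry \<open>u\<close> followed by a shifted word of length \<open>s\<close>\<close>
  have "(\<Sum>ys\<in>perm_words (Suc s). m ^ length (?R ys) * kernel m (Suc s) i (hd (?R ys))) =
     (\<Sum>(u, xs)\<in>{1..Suc s} \<times> perm_words s. m ^ length (?R (u # map (shift u) xs)) *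
        kernel m (Suc s) i (hd (?R (u # map (shift u) xs))))"
    by (subst sum.reindex_bij_betw[OF perm_words_prepend, symmetric]) (simp add: case_prod_unfold)
  also have "\<dots> = (\<Sum>xs\<in>perm_words s. \<Sum>u=1..Suc s. m ^ length (?R (u # map (shift u) xs)) *
        kernel m (Suc s) i (hd (?R (u # map (shift u) xs))))"
    by (subst sum.swap) (simp only: sum.cartesian_product)
  also have "\<dots> = (\<Sum>xs\<in>perm_words s. m ^ length (r xs) *
      (\<Sum>u=1..Suc s. if sign_rel e u (shift u (hd (r xs))) then m * kernel m (Suc s) i u
       else kernel m (Suc s) i (shift u (hd (r xs)))))"
    unfolding sum_distrib_left
  proof (intro sum.cong refl)
    fix xs u assume "xs \<in> perm_words s"
    then show "m ^ length (?R (u # map (shift u) xs)) * kernel m (Suc s) i (hd (?R (u # map (shift u) xs))) =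
       m ^ length (r xs) * (if sign_rel e u (shift u (hd (r xs))) then m * kernel m (Suc s) i u
       else kernel m (Suc s) i (shift u (hd (r xs))))"
      using r[of xs] record_values_strict_mono[OF strict_mono_shift, of xs es u]
      by (simp add: r_def[symmetric] list.map_sel)
  qed
  also have "\<dots> = (\<Sum>xs\<in>perm_words s. m ^ length (r xs) *
      ((s + m) * (\<Sum>j\<in>next_values m e i. kernel m s j (hd (r xs)))))"
    using r Cons.prems by (intro sum.cong refl arg_cong2[of _ _ _ _ "(*)"] kernel_record_step) auto
  also have "\<dots> = (s + m) * (\<Sum>j\<in>next_values m e i. \<Sum>xs\<in>perm_words s. m ^ length (r xs) * kernel m s j (hd (r xs)))"
    by (subst sum.swap) (simp add: sum_distrib_left mult_ac)
  also have "\<dots> = (s + m) * (\<Sum>j\<in>next_values m e i. pochhammer m s * zigzag_count m es j)"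
    using Cons.IH up unfolding s_def r_def by (intro arg_cong2[of _ _ _ _ "(*)"] sum.cong refl) blast
  also have "\<dots> = pochhammer m (Suc s) * zigzag_count m (e # es) i"
    by (simp add: pochhammer_rec' sum_distrib_left mult_ac add.commute)
  finally show ?case by (simp add: s_def)
qed

lemma pochhammer_eq_binomial:
  "pochhammer (Suc k) n = fact n * (n + k choose k)"
proof -
  have "fact k * pochhammer (Suc k) n = (fact (n + k) :: nat)"
  proof (induction n)
    case (Suc n)
    have "fact k * pochhammer (Suc k) (Suc n) = (Suc k + n) * (fact k * pochhammer (Suc k) n)"
      by (simp only: pochhammer_rec' mult.left_commute of_nat_id)
    then show ?case unfolding Suc.IH by (simp add: add.commute)
  qed simp
  moreover have "fact k * (fact n * (n + k choose k)) = (fact (n + k) :: nat)"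
    using binomial_fact_lemma[of k "n + k"] by (simp add: mult.assoc)
  ultimately show ?thesis by (metis fact_nonzero mult_left_cancel)
qed

text \<open>
  Summing \<open>weighted_record_sum\<close> over all \<open>i\<close> produces the constant \<open>kernel_sum\<close> on the left, and this
  constant divides the rising factorial with quotient the factorial.
\<close>

lemma record_generating_sum:
  assumes "1 \<le> m"
  shows "(\<Sum>xs\<in>perm_words (Suc (length es)). m ^ length (record_values es xs)) =
    fact (Suc (length es)) * (\<Sum>j=1..m. zigzag_count m es j)"
proof -
  let ?s = "Suc (length es)" and ?P = "perm_words (Suc (length es))"
  obtain k where k: "m = Suc k" using assms by (cases m) auto
  have "(?s + k choose k) * (\<Sum>xs\<in>?P. m ^ length (record_values es xs)) =
     (\<Sum>xs\<in>?P. m ^ length (record_values es xs) * (\<Sum>j=1..m. kernel m ?s j (hd (record_values es xs))))"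
    unfolding sum_distrib_left
  proof (rule sum.cong[OF refl])
    fix xs assume xs: "xs \<in> ?P"
    then have "hd (record_values es xs) \<in> set xs"
      using record_values_nonempty[of xs es] length_perm_words[OF xs] hd_in_set by blast
    then have "(\<Sum>j=1..m. kernel m ?s j (hd (record_values es xs))) = (?s + m - 1 choose (m - 1))"
      using xs assms by (intro kernel_sum) (auto simp: perm_words_def)
    then show "(?s + k choose k) * m ^ length (record_values es xs) =
       (\<Sum>j=1..m. m ^ length (record_values es xs) * kernel m ?s j (hd (record_values es xs)))"
      by (simp add: sum_distrib_left[symmetric] k mult.commute)
  qed
  also have "\<dots> = (\<Sum>j=1..m. pochhammer m ?s * zigzag_count m es j)"
    unfolding sum_distrib_left
    by (subst sum.swap) (intro sum.cong refl weighted_record_sum, auto)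
  also have "\<dots> = (?s + k choose k) * (fact ?s * (\<Sum>j=1..m. zigzag_count m es j))"
    unfolding sum_distrib_left[symmetric] k pochhammer_eq_binomial by (simp only: mult_ac)
  finally show ?thesis by (subst (asm) mult_cancel1) simp
qed

section \<open>Greedy records as a right-to-left scan\<close>

definition beats :: "step_sign list \<Rightarrow> (nat \<Rightarrow> nat) \<Rightarrow> nat \<Rightarrow> nat \<Rightarrow> bool" where
  "beats \<epsilon> \<pi> i k \<longleftrightarrow> sign_rel (sign_at \<epsilon> i) (\<pi> i) (\<pi> k)"

text \<open>
  The smallest record position that is at least \<open>n - d\<close>. Unlike the greedy rule, which jumps to a
  maximum, this scan moves by one position at a time, and so is a primitive recursion that agrees
  with the recursion of \<open>record_values\<close>. As long as \<open>d\<close> stays below \<open>n\<close>, position \<open>0\<close> is never inspected.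
\<close>

definition leftmost_record :: "(nat \<Rightarrow> nat \<Rightarrow> bool) \<Rightarrow> nat \<Rightarrow> nat \<Rightarrow> nat" where
  "leftmost_record R n d = rec_nat n (\<lambda>d r. if R (n - Suc d) r then n - Suc d else r) d"

lemma leftmost_record_simps [simp]:
  "leftmost_record R n 0 = n"
  "leftmost_record R n (Suc d) =
     (if R (n - Suc d) (leftmost_record R n d) then n - Suc d else leftmost_record R n d)"
  by (simp_all add: leftmost_record_def)

lemma leftmost_record_bounds: "d < n \<Longrightarrow> n - d \<le> leftmost_record R n d \<and> leftmost_record R n d \<le> n"
  by (induction d) auto

lemma record_candidates_eq: "record_candidates \<epsilon> \<pi> k = {i. 1 \<le> i \<and> i < k \<and> beats \<epsilon> \<pi> i k}"
proof -
  have "(case sign_at \<epsilon> i of Plus \<Rightarrow> \<pi> i > \<pi> k | Minus \<Rightarrow> \<pi> i < \<pi> k) = beats \<epsilon> \<pi> i k" for i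
    by (cases "sign_at \<epsilon> i") (auto simp: beats_def)
  then show ?thesis by (simp add: record_candidates_def)
qed

lemma finite_record_candidates: "finite (record_candidates \<epsilon> \<pi> k)"
  by (rule finite_subset[of _ "{..<k}"]) (auto simp: record_candidates_eq)

text \<open>
  Between a record and the next one chosen by the greedy rule there is no candidate, so the scan keeps
  the record until it reaches the next one. Conversely the scan changes its record only at a position
  that is the largest candidate, since it has rejected all positions in between.
\<close>

lemma greedy_records_eq:
  assumes "1 \<le> n"
  shows "greedy_records n \<epsilon> \<pi> = {k \<in> {1..n}. leftmost_record (beats \<epsilon> \<pi>) n (n - k) = k}"
    (is "_ = ?R")
proof (intro equalityI subsetI)
  let ?T = "leftmost_record (beats \<epsilon> \<pi>) n"
  fix k assume "k \<in> greedy_records n \<epsilon> \<pi>"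
  then show "k \<in> ?R"
  proof (induction rule: greedy_records.induct)
    case first
    then show ?case using assms by simp
  next
    case (step r)
    define k where "k = Max (record_candidates \<epsilon> \<pi> r)"
    have "k \<in> record_candidates \<epsilon> \<pi> r"
      using Max_in[OF finite_record_candidates step.hyps(2)] by (simp add: k_def)
    then have k: "1 \<le> k" "k < r" "beats \<epsilon> \<pi> k r" by (auto simp: record_candidates_eq)
    \<comment> \<open>a candidate in between would exceed the maximum\<close>
    have between: "\<not> beats \<epsilon> \<pi> i r" if "k < i" "i < r" for i
      using that Max_ge[OF finite_record_candidates, of i \<epsilon> \<pi> r] k unfolding k_def[symmetric]
      by (force simp: record_candidates_eq)
    have "?T d = r" if "n - r \<le> d" "d < n - k" for d
      using that
    proof (induction d rule: dec_induct)
      case base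
      then show ?case using step.IH by simp
    next
      case (step d)
      then show ?case using between[of "n - Suc d"] by auto
    qed
    moreover have "n - r \<le> n - Suc k" "n - Suc k < n - k" using k step.IH by auto
    ultimately have "?T (n - Suc k) = r" by blast
    moreover have "n - k = Suc (n - Suc k)" "n - Suc (n - Suc k) = k" using k step.IH by auto
    ultimately have "?T (n - k) = k" using k by simp
    then show ?case using k step.IH unfolding k_def[symmetric] by simp
  qed
next
  let ?T = "leftmost_record (beats \<epsilon> \<pi>) n"
  have "?T d \<in> greedy_records n \<epsilon> \<pi> \<and> (\<forall>i. n - d \<le> i \<and> i < ?T d \<longrightarrow> \<not> beats \<epsilon> \<pi> i (?T d))"
    if "d < n" for d
    using that
  proof (induction d)
    case 0
    then show ?case by (auto intro: greedy_records.first)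
  next
    case (Suc d)
    let ?i = "n - Suc d"
    have i: "1 \<le> ?i" "?i < n - d" using Suc.prems by auto
    have T: "n - d \<le> ?T d" using leftmost_record_bounds Suc.prems by auto
    show ?case
    proof (cases "beats \<epsilon> \<pi> ?i (?T d)")
      case True
      have "?i \<in> record_candidates \<epsilon> \<pi> (?T d)" using True i T by (auto simp: record_candidates_eq)
      moreover have "j \<le> ?i" if "j \<in> record_candidates \<epsilon> \<pi> (?T d)" for j
      proof -
        have "\<not> n - d \<le> j" using that Suc by (auto simp: record_candidates_eq)
        then show ?thesis by simp
      qed
      ultimately have "Max (record_candidates \<epsilon> \<pi> (?T d)) = ?i"
        using finite_record_candidates by (intro Max_eqI) auto
      moreover have "Max (record_candidates \<epsilon> \<pi> (?T d)) \<in> greedy_records n \<epsilon> \<pi>"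
        using Suc \<open>?i \<in> record_candidates \<epsilon> \<pi> (?T d)\<close> by (intro greedy_records.step) auto
      ultimately show ?thesis using True by auto
    next
      case False
      have "\<not> beats \<epsilon> \<pi> j (?T d)" if "?i \<le> j" "j < ?T d" for j
        using that False Suc by (cases "j = ?i") auto
      then show ?thesis using False Suc by auto
    qed
  qed
  note T = this
  fix k assume "k \<in> ?R"
  then show "k \<in> greedy_records n \<epsilon> \<pi>" using T[of "n - k"] by auto
qed

lemma finite_greedy_records: "1 \<le> n \<Longrightarrow> finite (greedy_records n \<epsilon> \<pi>)"
  by (simp add: greedy_records_eq)

text \<open>
  After \<open>d\<close> steps the scan has processed the suffix of the word that starts at position \<open>n - d\<close>.
\<close>

lemma record_values_leftmost:
  assumes "length \<epsilon> = n - 1" "d < n"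
  shows "hd (record_values (drop (n - Suc d) \<epsilon>) (map \<pi> [n - d..<Suc n])) =
      \<pi> (leftmost_record (beats \<epsilon> \<pi>) n d) \<and>
    length (record_values (drop (n - Suc d) \<epsilon>) (map \<pi> [n - d..<Suc n])) =
      card {c. c \<le> d \<and> leftmost_record (beats \<epsilon> \<pi>) n c = n - c}"
  using assms(2)
proof (induction d)
  case 0
  have "{c. c = 0 \<and> leftmost_record (beats \<epsilon> \<pi>) n c = n - c} = {0}" by auto
  then show ?case using assms(1) 0 by simp
next
  case (Suc d)
  let ?T = "leftmost_record (beats \<epsilon> \<pi>) n"
  let ?i = "n - Suc d"
  have i: "1 \<le> ?i" "n - d = Suc ?i" using Suc.prems by auto
  have drop: "drop (n - Suc (Suc d)) \<epsilon> = sign_at \<epsilon> ?i # drop (n - Suc d) \<epsilon>"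
    using Suc.prems assms(1) Cons_nth_drop_Suc[of "n - Suc (Suc d)" \<epsilon>]
    by (simp add: sign_at_def Suc_diff_Suc)
  have upt: "[?i..<Suc n] = ?i # [n - d..<Suc n]"
    using i by (metis Suc_n_not_le_n diff_le_self le_imp_less_Suc upt_conv_Cons)
  have T: "n - d \<le> ?T d" using leftmost_record_bounds Suc.prems by auto
  have split: "{c. c \<le> Suc d \<and> ?T c = n - c} =
     (if ?T (Suc d) = ?i then insert (Suc d) {c. c \<le> d \<and> ?T c = n - c} else {c. c \<le> d \<and> ?T c = n - c})"
    by (auto simp: le_Suc_eq simp del: leftmost_record_simps)
  have iff: "?T (Suc d) = ?i \<longleftrightarrow> beats \<epsilon> \<pi> ?i (?T d)" using T i by auto
  have fin: "finite {c. c \<le> d \<and> ?T c = n - c}" by simp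
  have "beats \<epsilon> \<pi> ?i (?T d) \<longleftrightarrow> sign_rel (sign_at \<epsilon> ?i) (\<pi> ?i) (\<pi> (?T d))"
    by (simp add: beats_def)
  then show ?case
    unfolding drop upt split iff using Suc fin
    by (auto simp: Let_def simp del: upt_Suc)
qed

lemma length_record_values:
  assumes "1 \<le> n" "length \<epsilon> = n - 1"
  shows "length (record_values \<epsilon> (map \<pi> [1..<Suc n])) =
    card {d. d < n \<and> leftmost_record (beats \<epsilon> \<pi>) n d = n - d}"
proof -
  have "n - (n - 1) = 1" "n - Suc (n - 1) = 0" using assms by auto
  moreover have "{c. c \<le> n - 1 \<and> leftmost_record (beats \<epsilon> \<pi>) n c = n - c} =
     {d. d < n \<and> leftmost_record (beats \<epsilon> \<pi>) n d = n - d}" using assms by auto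
  ultimately show ?thesis using record_values_leftmost[OF assms(2), of "n - 1" \<pi>] assms(1) by simp
qed

lemma card_greedy_records:
  assumes "1 \<le> n" "length \<epsilon> = n - 1"
  shows "card (greedy_records n \<epsilon> \<pi>) = length (record_values \<epsilon> (map \<pi> [1..<Suc n]))"
  unfolding length_record_values[OF assms] greedy_records_eq[OF assms(1)]
  by (rule bij_betw_same_card, rule bij_betwI[where f = "\<lambda>k. n - k" and g = "\<lambda>d. n - d"]) auto

section \<open>Codes of the two families of pairs\<close>

lemma bij_betw_PiE_lists:
  assumes "finite A"
  shows "bij_betw (\<lambda>g. map g (sorted_list_of_set A)) (A \<rightarrow>\<^sub>E B) {xs. length xs = card A \<and> set xs \<subseteq> B}"
proof -
  let ?L = "sorted_list_of_set A"
  have inj: "inj_on (\<lambda>g. map g ?L) (A \<rightarrow>\<^sub>E B)"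
  proof (rule inj_onI)
    fix g h assume "g \<in> A \<rightarrow>\<^sub>E B" "h \<in> A \<rightarrow>\<^sub>E B" "map g ?L = map h ?L"
    then show "g = h" using assms by (intro PiE_ext[of g A "\<lambda>_. B" h]) auto
  qed
  have "(\<lambda>g. map g ?L) ` (A \<rightarrow>\<^sub>E B) = {xs. length xs = card A \<and> set xs \<subseteq> B}"
  proof (intro equalityI subsetI)
    fix xs assume xs: "xs \<in> {xs. length xs = card A \<and> set xs \<subseteq> B}"
    define g where "g = restrict (\<lambda>a. xs ! (THE i. i < card A \<and> ?L ! i = a)) A"
    have g: "g (?L ! i) = xs ! i" if "i < card A" for i
    proof -
      have "(THE j. j < card A \<and> ?L ! j = ?L ! i) = i"
        using that nth_eq_iff_index_eq[OF distinct_sorted_list_of_set, of _ A i] by (intro the_equality) auto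
      moreover have "?L ! i \<in> A" using that assms by (metis length_sorted_list_of_set nth_mem set_sorted_list_of_set)
      ultimately show ?thesis by (simp add: g_def)
    qed
    have "map g ?L = xs" using g xs by (intro nth_equalityI) auto
    moreover from this have "g ` A \<subseteq> B" using xs assms by (metis (mono_tags) list.set_map mem_Collect_eq set_sorted_list_of_set)
    then have "g \<in> A \<rightarrow>\<^sub>E B" by (auto simp: g_def)
    ultimately show "xs \<in> (\<lambda>g. map g ?L) ` (A \<rightarrow>\<^sub>E B)" by blast
  qed (use assms in \<open>auto simp: PiE_def\<close>)
  with inj show ?thesis by (simp add: bij_betw_def)
qed

lemma sorted_list_of_atLeast_one: "sorted_list_of_set {1..n} = [1..<Suc n]"
  by (metis atLeastLessThanSuc_atLeastAtMost sorted_list_of_set_range)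

lemma bij_betw_permutes_perm_words:
  "bij_betw (\<lambda>\<pi>. map \<pi> [1..<Suc n]) {\<pi>. \<pi> permutes {1..n}} (perm_words n)"
proof (rule bij_betwI[where g = "\<lambda>xs i. if i \<in> {1..n} then xs ! (i - 1) else i"])
  show "(\<lambda>\<pi>. map \<pi> [1..<Suc n]) \<in> {\<pi>. \<pi> permutes {1..n}} \<rightarrow> perm_words n"
  proof (rule funcsetI)
    fix \<pi> assume "\<pi> \<in> {\<pi>. \<pi> permutes {1..n}}"
    then have "\<pi> ` {1..n} = {1..n}" "inj_on \<pi> {1..n}" by (auto simp: permutes_image permutes_inj_on)
    moreover have "set [1..<Suc n] = {1..n}" by auto
    ultimately show "map \<pi> [1..<Suc n] \<in> perm_words n"
      unfolding perm_words_def by (simp only: mem_Collect_eq distinct_map distinct_upt set_map simp_thms)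
  qed
  show "(\<lambda>xs i. if i \<in> {1..n} then xs ! (i - 1) else i) \<in> perm_words n \<rightarrow> {\<pi>. \<pi> permutes {1..n}}"
  proof (rule funcsetI, rule CollectI)
    fix xs assume xs: "xs \<in> perm_words n"
    let ?p = "\<lambda>i. if i \<in> {1..n} then xs ! (i - 1) else i"
    have len: "length xs = n" using length_perm_words[OF xs] .
    have nth: "bij_betw ((!) xs) {..<n} {1..n}"
      using xs bij_betw_nth[of xs "{..<n}" "{1..n}"] len by (simp add: perm_words_def)
    have "bij_betw (\<lambda>i. i - 1) {1..n} {..<n}"
      by (rule bij_betwI[where g = Suc]) auto
    from bij_betw_trans[OF this nth] have "bij_betw ?p {1..n} {1..n}"
      by (rule bij_betw_cong[THEN iffD1, rotated]) auto
    then show "?p permutes {1..n}" by (rule bij_imp_permutes) auto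
  qed
  show "(\<lambda>i. if i \<in> {1..n} then map \<pi> [1..<Suc n] ! (i - 1) else i) = \<pi>"
    if "\<pi> \<in> {\<pi>. \<pi> permutes {1..n}}" for \<pi>
    using that by (auto simp: fun_eq_iff permutes_def nth_append simp del: upt_Suc)
  show "map (\<lambda>i. if i \<in> {1..n} then xs ! (i - 1) else i) [1..<Suc n] = xs" if "xs \<in> perm_words n" for xs
    using length_perm_words[OF that] by (intro nth_equalityI) (auto simp del: upt_Suc)
qed

text \<open>
  Monotonicity along the generating steps passes to their transitive closure.
\<close>

lemma order_preserving_iff:
  assumes "f \<in> {1..n} \<rightarrow>\<^sub>E {1..m}"
  shows "f \<in> order_preserving_maps m n \<epsilon> \<longleftrightarrow>
    (\<forall>i. 1 \<le> i \<and> i < n \<longrightarrow> f (Suc i) \<in> next_values m (sign_at \<epsilon> i) (f i))"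
proof -
  have range: "f i \<in> {1..m}" if "i \<in> {1..n}" for i using assms that by blast
  have up: "f (Suc i) \<in> next_values m (sign_at \<epsilon> i) (f i) \<longleftrightarrow>
      (case sign_at \<epsilon> i of Plus \<Rightarrow> f (Suc i) \<le> f i | Minus \<Rightarrow> f i \<le> f (Suc i))"
    if "1 \<le> i" "i < n" for i
    using range[of "Suc i"] that by (cases "sign_at \<epsilon> i") auto
  have "monotone_on {1..n} (zigzag_le n \<epsilon>) (\<le>) f \<longleftrightarrow> (\<forall>(a, b) \<in> zigzag_step n \<epsilon>. f a \<le> f b)"
  proof
    assume "monotone_on {1..n} (zigzag_le n \<epsilon>) (\<le>) f"
    moreover have "a \<in> {1..n} \<and> b \<in> {1..n}" if "(a, b) \<in> zigzag_step n \<epsilon>" for a b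
      using that by (auto simp: zigzag_step_def)
    ultimately show "\<forall>(a, b) \<in> zigzag_step n \<epsilon>. f a \<le> f b"
      unfolding monotone_on_def zigzag_le_def by blast
  next
    assume step: "\<forall>(a, b) \<in> zigzag_step n \<epsilon>. f a \<le> f b"
    have "f a \<le> f b" if "(a, b) \<in> (zigzag_step n \<epsilon>)\<^sup>*" for a b
      using that by (induction rule: rtrancl_induct) (use step in \<open>auto intro: order_trans\<close>)
    then show "monotone_on {1..n} (zigzag_le n \<epsilon>) (\<le>) f"
      by (auto simp: monotone_on_def zigzag_le_def)
  qed
  also have "\<dots> \<longleftrightarrow> (\<forall>i. 1 \<le> i \<and> i < n \<longrightarrow>
      (case sign_at \<epsilon> i of Plus \<Rightarrow> f (Suc i) \<le> f i | Minus \<Rightarrow> f i \<le> f (Suc i)))"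
    by (fastforce simp: zigzag_step_def split: step_sign.splits)
  finally show ?thesis using up assms by (simp add: order_preserving_maps_def)
qed

lemma bij_betw_order_preserving_zigzag_words:
  assumes "1 \<le> n" "length \<epsilon> = n - 1"
  shows "bij_betw (\<lambda>f. map f [1..<Suc n]) (order_preserving_maps m n \<epsilon>) (zigzag_words m \<epsilon>)"
proof -
  let ?h = "\<lambda>f. map f [1..<Suc n]"
  have bij: "bij_betw ?h ({1..n} \<rightarrow>\<^sub>E {1..m}) {xs. length xs = n \<and> set xs \<subseteq> {1..m}}"
    using bij_betw_PiE_lists[of "{1..n}" "{1..m}"] by (simp only: sorted_list_of_atLeast_one card_atLeastAtMost finite_atLeastAtMost diff_Suc_1)
  have iff: "?h f \<in> zigzag_words m \<epsilon> \<longleftrightarrow> f \<in> order_preserving_maps m n \<epsilon>" if f: "f \<in> {1..n} \<rightarrow>\<^sub>E {1..m}" for f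
  proof -
    have "?h f \<in> {xs. length xs = n \<and> set xs \<subseteq> {1..m}}" using bij_betwE[OF bij] f by blast
    then have "?h f \<in> zigzag_words m \<epsilon> \<longleftrightarrow> (\<forall>i<n - 1. ?h f ! Suc i \<in> next_values m (\<epsilon> ! i) (?h f ! i))"
      using assms by (simp add: zigzag_words_def)
    also have "\<dots> \<longleftrightarrow> (\<forall>i<n - 1. f (Suc (Suc i)) \<in> next_values m (sign_at \<epsilon> (Suc i)) (f (Suc i)))"
      by (auto simp: sign_at_def simp del: upt_Suc)
    also have "\<dots> \<longleftrightarrow> (\<forall>i. 1 \<le> i \<and> i < n \<longrightarrow> f (Suc i) \<in> next_values m (sign_at \<epsilon> i) (f i))"
      by (auto simp: less_diff_conv) (metis Suc_le_D Suc_le_eq)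
    finally show ?thesis using order_preserving_iff[OF f] by simp
  qed
  have sub: "order_preserving_maps m n \<epsilon> \<subseteq> {1..n} \<rightarrow>\<^sub>E {1..m}" by (auto simp: order_preserving_maps_def)
  have "?h ` order_preserving_maps m n \<epsilon> = zigzag_words m \<epsilon>"
  proof (intro equalityI subsetI)
    fix xs assume xs: "xs \<in> zigzag_words m \<epsilon>"
    then have "xs \<in> {xs. length xs = n \<and> set xs \<subseteq> {1..m}}" using assms by (auto simp: zigzag_words_def)
    then obtain f where "f \<in> {1..n} \<rightarrow>\<^sub>E {1..m}" "xs = ?h f" using bij unfolding bij_betw_def by blast
    then show "xs \<in> ?h ` order_preserving_maps m n \<epsilon>" using iff xs by blast
  qed (use iff sub in auto)
  then show ?thesis using bij_betw_subset[OF bij sub] by blast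
qed

text \<open>
  The sets of codes are described by conditions on the decoded lists only, which is the form in which
  they are counted and decided.
\<close>

definition order_codes :: "nat \<Rightarrow> nat \<Rightarrow> step_sign list \<Rightarrow> nat set" where
  "order_codes m n \<epsilon> = {c. list_decode (fst (prod_decode c)) \<in> perm_words n \<and>
     list_decode (snd (prod_decode c)) \<in> zigzag_words m \<epsilon>}"

definition record_codes :: "nat \<Rightarrow> nat \<Rightarrow> step_sign list \<Rightarrow> nat set" where
  "record_codes m n \<epsilon> = {c. list_decode (fst (prod_decode c)) \<in> perm_words n \<and>
     length (list_decode (snd (prod_decode c))) = length (record_values \<epsilon> (list_decode (fst (prod_decode c)))) \<and>
     set (list_decode (snd (prod_decode c))) \<subseteq> {1..m}}"

definition pair_code :: "nat list \<times> nat list \<Rightarrow> nat" where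
  "pair_code = (\<lambda>(xs, ys). prod_encode (list_encode xs, list_encode ys))"

lemma bij_betw_order_codes:
  "bij_betw pair_code (perm_words n \<times> zigzag_words m \<epsilon>) (order_codes m n \<epsilon>)"
  by (rule bij_betwI[where g = "\<lambda>c. (list_decode (fst (prod_decode c)), list_decode (snd (prod_decode c)))"])
    (auto simp: order_codes_def pair_code_def)

lemma bij_betw_record_codes:
  "bij_betw pair_code
     (SIGMA xs:perm_words n. {ys. set ys \<subseteq> {1..m} \<and> length ys = length (record_values \<epsilon> xs)})
     (record_codes m n \<epsilon>)"
  by (rule bij_betwI[where g = "\<lambda>c. (list_decode (fst (prod_decode c)), list_decode (snd (prod_decode c)))"])
    (auto simp: record_codes_def pair_code_def)

lemma bij_betw_code_order_pair:
  assumes "1 \<le> n" "length \<epsilon> = n - 1"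
  shows "bij_betw (code_order_pair n) (perm_order_pairs m n \<epsilon>) (order_codes m n \<epsilon>)"
proof -
  let ?h = "\<lambda>g. map g [1..<Suc n]"
  have "bij_betw (map_prod ?h ?h) ({\<pi>. \<pi> permutes {1..n}} \<times> order_preserving_maps m n \<epsilon>)
     (perm_words n \<times> zigzag_words m \<epsilon>)"
    by (intro bij_betw_map_prod bij_betw_permutes_perm_words bij_betw_order_preserving_zigzag_words assms)
  then have "bij_betw (pair_code \<circ> map_prod ?h ?h)
     ({\<pi>. \<pi> permutes {1..n}} \<times> order_preserving_maps m n \<epsilon>) (order_codes m n \<epsilon>)"
    using bij_betw_order_codes by (rule bij_betw_trans)
  moreover have "pair_code \<circ> map_prod ?h ?h = code_order_pair n"
    by (auto simp: fun_eq_iff pair_code_def code_order_pair_def code_map_def sorted_list_of_atLeast_one[unfolded One_nat_def])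
  moreover have "{\<pi>. \<pi> permutes {1..n}} \<times> order_preserving_maps m n \<epsilon> = perm_order_pairs m n \<epsilon>"
    by (auto simp: perm_order_pairs_def)
  ultimately show ?thesis by simp
qed

text \<open>
  The list of colours does not show which positions it belongs to. The code is still injective, because
  the permutation is decoded first and determines the records.
\<close>

lemma bij_betw_code_record_pair:
  assumes "1 \<le> n" "length \<epsilon> = n - 1"
  shows "bij_betw (code_record_pair n \<epsilon>) (perm_record_pairs m n \<epsilon>) (record_codes m n \<epsilon>)"
proof -
  let ?h = "\<lambda>g. map g [1..<Suc n]"
  let ?R = "greedy_records n \<epsilon>"
  have code: "code_record_pair n \<epsilon> (\<pi>, l) =
      prod_encode (list_encode (?h \<pi>), list_encode (map l (sorted_list_of_set (?R \<pi>))))" for \<pi> l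
    by (simp add: code_record_pair_def code_map_def sorted_list_of_atLeast_one del: upt_Suc One_nat_def)
  have bij: "bij_betw (\<lambda>g. map g (sorted_list_of_set (?R \<pi>))) (?R \<pi> \<rightarrow>\<^sub>E {1..m})
     {xs. length xs = length (record_values \<epsilon> (?h \<pi>)) \<and> set xs \<subseteq> {1..m}}" for \<pi>
    using bij_betw_PiE_lists[OF finite_greedy_records[OF assms(1)], of \<epsilon> \<pi> "{1..m}"]
    by (simp only: card_greedy_records[OF assms])
  have "inj_on (code_record_pair n \<epsilon>) (perm_record_pairs m n \<epsilon>)"
  proof (rule inj_onI, clarify)
    fix \<pi> l \<pi>' l'
    assume *: "(\<pi>, l) \<in> perm_record_pairs m n \<epsilon>" "(\<pi>', l') \<in> perm_record_pairs m n \<epsilon>"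
      "code_record_pair n \<epsilon> (\<pi>, l) = code_record_pair n \<epsilon> (\<pi>', l')"
    then have "?h \<pi> = ?h \<pi>'" "\<pi> permutes {1..n}" "\<pi>' permutes {1..n}"
      unfolding code by (auto simp: list_encode_eq perm_record_pairs_def simp del: upt_Suc)
    then have \<pi>: "\<pi> = \<pi>'"
      using bij_betw_permutes_perm_words[of n] by (auto simp: bij_betw_def dest: inj_onD)
    have "l \<in> ?R \<pi> \<rightarrow>\<^sub>E {1..m}" "l' \<in> ?R \<pi> \<rightarrow>\<^sub>E {1..m}"
      "map l (sorted_list_of_set (?R \<pi>)) = map l' (sorted_list_of_set (?R \<pi>))"
      using * unfolding code \<pi> by (simp_all only: prod_encode_eq list_encode_eq prod.inject perm_record_pairs_def mem_Collect_eq case_prod_conv simp_thms)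
    then have "l = l'" using bij[of \<pi>] by (meson bij_betw_def inj_onD)
    with \<pi> show "\<pi> = \<pi>' \<and> l = l'" by simp
  qed
  moreover have "code_record_pair n \<epsilon> ` perm_record_pairs m n \<epsilon> = record_codes m n \<epsilon>"
  proof (intro equalityI subsetI)
    fix c assume "c \<in> code_record_pair n \<epsilon> ` perm_record_pairs m n \<epsilon>"
    then obtain \<pi> l where "\<pi> permutes {1..n}" "l \<in> ?R \<pi> \<rightarrow>\<^sub>E {1..m}" and c: "c = code_record_pair n \<epsilon> (\<pi>, l)"
      by (auto simp: perm_record_pairs_def)
    then have "?h \<pi> \<in> perm_words n" "map l (sorted_list_of_set (?R \<pi>)) \<in>
        {xs. length xs = length (record_values \<epsilon> (?h \<pi>)) \<and> set xs \<subseteq> {1..m}}"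
      using bij_betwE[OF bij_betw_permutes_perm_words] bij_betwE[OF bij] by blast+
    then show "c \<in> record_codes m n \<epsilon>"
      unfolding c code record_codes_def
      by (simp only: mem_Collect_eq prod_encode_inverse fst_conv snd_conv list_encode_inverse simp_thms)
  next
    fix c assume "c \<in> record_codes m n \<epsilon>"
    moreover define xs ys where "xs = list_decode (fst (prod_decode c))" "ys = list_decode (snd (prod_decode c))"
    ultimately have *: "xs \<in> perm_words n" "length ys = length (record_values \<epsilon> xs)" "set ys \<subseteq> {1..m}"
      by (auto simp: record_codes_def)
    from *(1) obtain \<pi> where \<pi>: "\<pi> permutes {1..n}" "xs = ?h \<pi>"
      using bij_betw_permutes_perm_words[of n] unfolding bij_betw_def by blast
    from * obtain l where l: "l \<in> ?R \<pi> \<rightarrow>\<^sub>E {1..m}" "ys = map l (sorted_list_of_set (?R \<pi>))"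
      using bij[of \<pi>] unfolding bij_betw_def \<pi>(2) by blast
    have "c = code_record_pair n \<epsilon> (\<pi>, l)"
      unfolding code \<pi>(2)[symmetric] l(2)[symmetric] xs_ys_def by simp
    then show "c \<in> code_record_pair n \<epsilon> ` perm_record_pairs m n \<epsilon>"
      using \<pi> l by (auto simp: perm_record_pairs_def)
  qed
  ultimately show ?thesis by (simp add: bij_betw_def)
qed

lemma card_perm_words: "card (perm_words n) = fact n"
proof -
  have "card {\<pi>. \<pi> permutes {1..n}} = fact n" by (rule card_permutations) auto
  then show ?thesis using bij_betw_same_card[OF bij_betw_permutes_perm_words] by metis
qed

lemma finite_order_codes: "finite (order_codes m n \<epsilon>)"
  using bij_betw_finite[OF bij_betw_order_codes] finite_perm_words finite_zigzag_lists by blast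

lemma finite_record_codes: "finite (record_codes m n \<epsilon>)"
  using bij_betw_finite[OF bij_betw_record_codes] finite_perm_words finite_lists_length_eq[of "{1..m}"]
  by (meson finite_SigmaI finite_atLeastAtMost)

text \<open>
  The counting identity behind the bijection, expressed for codes.
\<close>

lemma card_order_codes_eq_card_record_codes:
  assumes "1 \<le> m" "1 \<le> n" "length \<epsilon> = n - 1"
  shows "card (order_codes m n \<epsilon>) = card (record_codes m n \<epsilon>)"
proof -
  have n: "n = Suc (length \<epsilon>)" using assms by simp
  have "card (order_codes m n \<epsilon>) = fact n * (\<Sum>j=1..m. zigzag_count m \<epsilon> j)"
    using bij_betw_same_card[OF bij_betw_order_codes, of n m \<epsilon>]
    by (simp add: card_cartesian_product card_perm_words card_zigzag_lists)
  also have "\<dots> = (\<Sum>xs\<in>perm_words n. m ^ length (record_values \<epsilon> xs))"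
    using record_generating_sum[OF assms(1), of \<epsilon>] by (simp only: n)
  also have "\<dots> = (\<Sum>xs\<in>perm_words n. card {ys. set ys \<subseteq> {1..m} \<and> length ys = length (record_values \<epsilon> xs)})"
    by (simp add: card_lists_length_eq)
  also have "\<dots> = card (SIGMA xs:perm_words n. {ys. set ys \<subseteq> {1..m} \<and> length ys = length (record_values \<epsilon> xs)})"
    using finite_perm_words finite_lists_length_eq[of "{1..m}"] by (subst card_SigmaI) auto
  also have "\<dots> = card (record_codes m n \<epsilon>)"
    by (rule bij_betw_same_card[OF bij_betw_record_codes])
  finally show ?thesis .
qed

section \<open>Decidability of the codes\<close>

text \<open>
  Every list of numbers decodes to a list of signs, so the length is the only condition on the
  codes of sign sequences.
\<close>

definition decode_signs :: "nat \<Rightarrow> step_sign list" where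
  "decode_signs c = map (\<lambda>k. if k = 1 then Plus else Minus) (list_decode c)"

lemma decode_signs_code: "decode_signs (code_signs \<epsilon>) = \<epsilon>"
proof -
  have "(if (case s of Plus \<Rightarrow> 1 | Minus \<Rightarrow> 0) = (1::nat) then Plus else Minus) = s" for s
    by (cases s) auto
  then show ?thesis by (simp add: decode_signs_def code_signs_def comp_def)
qed

abbreviation entry :: "nat \<Rightarrow> nat \<Rightarrow> nat" where
  "entry c i \<equiv> nth_default 0 (list_decode c) i"

lemma decidable_perm_words:
  assumes "computable k a" "computable k b"
  shows "decidable k (\<lambda>xs. list_decode (b xs) \<in> perm_words (a xs))"
proof (rule decidable_comp2[of "\<lambda>n c. list_decode c \<in> perm_words n"])
  have *: "length (list_decode c) = n \<and> (\<forall>i<n. 1 \<le> entry c i \<and> entry c i \<le> n \<and>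
      (\<forall>j<i. entry c i \<noteq> entry c j)) \<longleftrightarrow> list_decode c \<in> perm_words n" (is "?L \<longleftrightarrow> ?R") for n c
  proof
    assume L: ?L
    let ?xs = "list_decode c"
    have nth: "1 \<le> ?xs ! i" "?xs ! i \<le> n" "j < i \<Longrightarrow> ?xs ! i \<noteq> ?xs ! j" if "i < n" for i j
      using L that by (auto simp: nth_default_def split: if_splits)
    have "?xs ! i \<noteq> ?xs ! j" if "i < n" "j < n" "i \<noteq> j" for i j
      using nth(3)[of i j] nth(3)[of j i] that by (cases i j rule: linorder_cases) auto
    then have dist: "distinct ?xs" using L by (auto simp: distinct_conv_nth)
    have "set ?xs \<subseteq> {1..n}" using nth L by (auto simp: in_set_conv_nth)
    moreover have "card (set ?xs) = card {1..n}" using distinct_card[OF dist] L by simp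
    ultimately have "set ?xs = {1..n}" by (intro card_subset_eq) auto
    then show ?R using dist by (simp add: perm_words_def)
  next
    assume R: ?R
    have len: "length (list_decode c) = n" using length_perm_words[OF R] .
    have "list_decode c ! i \<in> {1..n}" if "i < n" for i
    proof -
      have "list_decode c ! i \<in> set (list_decode c)" using that len by simp
      then show ?thesis using R unfolding perm_words_def by blast
    qed
    then show ?L using R len
      by (auto simp: nth_default_def perm_words_def nth_eq_iff_index_eq)
  qed
  have "decidable 2 (\<lambda>xs. length (list_decode (xs!1)) = xs!0 \<and> (\<forall>i<xs!0. 1 \<le> entry (xs!1) i \<and>
      entry (xs!1) i \<le> xs!0 \<and> (\<forall>j<i. entry (xs!1) i \<noteq> entry (xs!1) j)))"
    by (intro computable_intros computable_nth_default computable_length) auto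
  then show "decidable 2 (\<lambda>xs. list_decode (xs!1) \<in> perm_words (xs!0))" unfolding * .
qed (use assms in auto)

lemma decidable_range:
  assumes "computable k a" "computable k b"
  shows "decidable k (\<lambda>xs. set (list_decode (b xs)) \<subseteq> {1..a xs})"
proof (rule decidable_comp2[of "\<lambda>m c. set (list_decode c) \<subseteq> {1..m}"])
  have *: "(\<forall>i<length (list_decode c). 1 \<le> entry c i \<and> entry c i \<le> m) \<longleftrightarrow>
      set (list_decode c) \<subseteq> {1..m}" for m c
    by (auto simp: nth_default_def subset_eq all_set_conv_all_nth split: if_splits)
  have "decidable 2 (\<lambda>xs. \<forall>i<length (list_decode (xs!1)). 1 \<le> entry (xs!1) i \<and> entry (xs!1) i \<le> xs!0)"
    by (intro computable_intros computable_nth_default computable_length) auto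
  then show "decidable 2 (\<lambda>xs. set (list_decode (xs!1)) \<subseteq> {1..xs!0})" unfolding * .
qed (use assms in auto)

lemma decidable_zigzag_lists:
  assumes "computable k a" "computable k b" "computable k c"
  shows "decidable k (\<lambda>xs. list_decode (c xs) \<in> zigzag_words (a xs) (decode_signs (b xs)))"
proof (rule decidable_comp3[of "\<lambda>m e f. list_decode f \<in> zigzag_words m (decode_signs e)"])
  have *: "length (list_decode f) = Suc (length (list_decode e)) \<and> set (list_decode f) \<subseteq> {1..m} \<and>
      (\<forall>i<length (list_decode e). (entry e i = 1 \<longrightarrow> entry f (Suc i) \<le> entry f i) \<and>
        (\<not> entry e i = 1 \<longrightarrow> entry f i \<le> entry f (Suc i))) \<longleftrightarrow>
     list_decode f \<in> zigzag_words m (decode_signs e)" for m e f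
  proof -
    have "list_decode f ! Suc i \<in> next_values m (decode_signs e ! i) (list_decode f ! i) \<longleftrightarrow>
      (entry e i = 1 \<longrightarrow> entry f (Suc i) \<le> entry f i) \<and>
        (\<not> entry e i = 1 \<longrightarrow> entry f i \<le> entry f (Suc i))"
      if "i < length (list_decode e)" "length (list_decode f) = Suc (length (list_decode e))"
        "set (list_decode f) \<subseteq> {1..m}" for i
    proof -
      have "list_decode f ! Suc i \<in> {1..m}" using that(3) nth_mem[of "Suc i" "list_decode f"] that(1,2)
        by (metis Suc_mono subsetD)
      then show ?thesis using that by (auto simp: nth_default_def decode_signs_def)
    qed
    moreover have "length (decode_signs e) = length (list_decode e)" by (simp add: decode_signs_def)
    ultimately show ?thesis unfolding zigzag_words_def mem_Collect_eq by auto
  qed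
  have "decidable 3 (\<lambda>xs. length (list_decode (xs!2)) = Suc (length (list_decode (xs!1))) \<and>
      set (list_decode (xs!2)) \<subseteq> {1..xs!0} \<and>
      (\<forall>i<length (list_decode (xs!1)). (entry (xs!1) i = 1 \<longrightarrow> entry (xs!2) (Suc i) \<le> entry (xs!2) i) \<and>
        (\<not> entry (xs!1) i = 1 \<longrightarrow> entry (xs!2) i \<le> entry (xs!2) (Suc i))))"
    by (intro computable_intros computable_nth_default computable_length decidable_range) auto
  then show "decidable 3 (\<lambda>xs. list_decode (xs!2) \<in> zigzag_words (xs!0) (decode_signs (xs!1)))"
    unfolding * .
qed (use assms in auto)

text \<open>
  \<open>beats\<close> read off from codes of the sign sequence and the permutation. Outside the range of the lists
  entries default to \<open>0\<close>, so the two agree for \<open>1 \<le> i < n\<close> only.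
\<close>

definition coded_beats :: "nat \<Rightarrow> nat \<Rightarrow> nat \<Rightarrow> nat \<Rightarrow> bool" where
  "coded_beats e p i k \<longleftrightarrow>
     (entry e (i - 1) = 1 \<longrightarrow> entry p (i - 1) > entry p (k - 1)) \<and>
     (\<not> entry e (i - 1) = 1 \<longrightarrow> entry p (i - 1) < entry p (k - 1))"

lemma leftmost_record_cong:
  assumes "d < n" "\<And>i k. 1 \<le> i \<Longrightarrow> i < n \<Longrightarrow> R i k \<longleftrightarrow> R' i k"
  shows "leftmost_record R n d = leftmost_record R' n d"
  using assms(1) by (induction d) (auto simp: assms(2))

definition record_count :: "nat \<Rightarrow> nat \<Rightarrow> nat \<Rightarrow> nat" where
  "record_count n e p = card {d. d < n \<and> leftmost_record (coded_beats e p) n d = n - d}"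

lemma record_count:
  assumes "1 \<le> n" "length (list_decode e) = n - 1" "length (list_decode p) = n"
  shows "record_count n e p = length (record_values (decode_signs e) (list_decode p))"
proof -
  let ?\<pi> = "\<lambda>i. entry p (i - 1)"
  have "map ?\<pi> [1..<Suc n] = list_decode p"
    using assms by (intro nth_equalityI) (auto simp: nth_default_def simp del: upt_Suc)
  moreover have "length (decode_signs e) = n - 1" using assms by (simp add: decode_signs_def)
  moreover have "coded_beats e p i k = beats (decode_signs e) ?\<pi> i k" if "1 \<le> i" "i < n" for i k
  proof -
    have "i - 1 < length (list_decode e)" using that assms by simp
    then have "entry e (i - 1) = list_decode e ! (i - 1)" by (simp add: nth_default_def)
    then show ?thesis using \<open>i - 1 < _\<close>
      by (simp add: coded_beats_def beats_def sign_at_def decode_signs_def)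
  qed
  then have "{d. d < n \<and> leftmost_record (coded_beats e p) n d = n - d} =
     {d. d < n \<and> leftmost_record (beats (decode_signs e) ?\<pi>) n d = n - d}"
    using leftmost_record_cong[of _ n "coded_beats e p" "beats (decode_signs e) ?\<pi>"] by auto
  ultimately show ?thesis
    using length_record_values[OF assms(1), of "decode_signs e" ?\<pi>] by (simp only: record_count_def)
qed

lemma computable_leftmost_record:
  "computable 4 (\<lambda>xs. leftmost_record (coded_beats (xs!0) (xs!1)) (xs!2) (xs!3))"
  unfolding leftmost_record_def coded_beats_def
  by (rule computable_rec_nat) (intro computable_intros computable_nth_default; simp)+

lemma computable_record_count: "computable 3 (\<lambda>xs. record_count (xs!0) (xs!1) (xs!2))"
  unfolding record_count_def
  by (intro computable_intros computable_comp4[OF computable_leftmost_record]) auto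

text \<open>
  The algorithms must terminate on all inputs, and the cardinalities are known to agree only for
  meaningful parameters. For all others the sets of codes are taken to be empty.
\<close>

definition valid_parameters :: "nat \<Rightarrow> nat \<Rightarrow> nat \<Rightarrow> bool" where
  "valid_parameters m n e \<longleftrightarrow> 1 \<le> m \<and> 1 \<le> n \<and> length (list_decode e) = n - 1"

definition valid_order_codes :: "nat \<Rightarrow> nat \<Rightarrow> nat \<Rightarrow> nat set" where
  "valid_order_codes m n e = {c. valid_parameters m n e \<and> c \<in> order_codes m n (decode_signs e)}"

definition valid_record_codes :: "nat \<Rightarrow> nat \<Rightarrow> nat \<Rightarrow> nat set" where
  "valid_record_codes m n e = {c. valid_parameters m n e \<and> c \<in> record_codes m n (decode_signs e)}"

lemma decidable_order_codes:
  "decidable 4 (\<lambda>xs. xs!3 \<in> valid_order_codes (xs!0) (xs!1) (xs!2))"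
  unfolding valid_order_codes_def valid_parameters_def order_codes_def mem_Collect_eq
  by (intro computable_intros computable_length decidable_perm_words decidable_zigzag_lists
      computable_fst_prod_decode computable_snd_prod_decode) auto

lemma decidable_record_codes:
  "decidable 4 (\<lambda>xs. xs!3 \<in> valid_record_codes (xs!0) (xs!1) (xs!2))"
proof (rule decidable_cong)
  let ?p = "\<lambda>xs. fst (prod_decode (xs!3))" and ?l = "\<lambda>xs. snd (prod_decode (xs!3))"
  show "decidable 4 (\<lambda>xs. valid_parameters (xs!0) (xs!1) (xs!2) \<and> list_decode (?p xs) \<in> perm_words (xs!1) \<and>
     length (list_decode (?l xs)) = record_count (xs!1) (xs!2) (?p xs) \<and> set (list_decode (?l xs)) \<subseteq> {1..xs!0})"
    unfolding valid_parameters_def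
    by (intro computable_intros computable_length decidable_perm_words decidable_range
      computable_fst_prod_decode computable_snd_prod_decode computable_comp3[OF computable_record_count]) auto
  show "(valid_parameters (xs!0) (xs!1) (xs!2) \<and> list_decode (?p xs) \<in> perm_words (xs!1) \<and>
     length (list_decode (?l xs)) = record_count (xs!1) (xs!2) (?p xs) \<and> set (list_decode (?l xs)) \<subseteq> {1..xs!0})
    \<longleftrightarrow> xs!3 \<in> valid_record_codes (xs!0) (xs!1) (xs!2)" for xs
    using record_count[of "xs!1" "xs!2" "?p xs"] length_perm_words[of "list_decode (?p xs)" "xs!1"]
    by (auto simp: valid_record_codes_def record_codes_def valid_parameters_def)
qed

section \<open>The bijection\<close>

theorem corollary6p7:
  shows "\<exists>\<Phi> :: nat \<Rightarrow> nat \<Rightarrow> step_sign list \<Rightarrow>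
            (nat \<Rightarrow> nat) \<times> (nat \<Rightarrow> nat) \<Rightarrow> (nat \<Rightarrow> nat) \<times> (nat \<Rightarrow> nat).
    algorithmic_family \<Phi> \<and>
    (\<forall>m n \<epsilon>. m \<ge> 1 \<longrightarrow> n \<ge> 1 \<longrightarrow> length \<epsilon> = n - 1 \<longrightarrow>
       bij_betw (\<Phi> m n \<epsilon>) (perm_order_pairs m n \<epsilon>) (perm_record_pairs m n \<epsilon>))"
proof -
  let ?X = valid_order_codes and ?Y = valid_record_codes
  define \<Phi> where "\<Phi> m n \<epsilon> x = inv_into (perm_record_pairs m n \<epsilon>) (code_record_pair n \<epsilon>)
     (rank_match (order_codes m n \<epsilon>) (record_codes m n \<epsilon>) (code_order_pair n x))" for m n \<epsilon> x
  have fin: "finite (?X m n e)" "finite (?Y m n e)" for m n e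
    using finite_order_codes[of m n "decode_signs e"] finite_record_codes[of m n "decode_signs e"]
    by (auto simp: valid_order_codes_def valid_record_codes_def)
  have card: "card (?X m n e) = card (?Y m n e)" for m n e
    using card_order_codes_eq_card_record_codes[of m n "decode_signs e"]
    by (cases "valid_parameters m n e")
      (auto simp: valid_order_codes_def valid_record_codes_def valid_parameters_def decode_signs_def)
  obtain F where F: "total_recursive 4 F"
    "\<And>xs. length xs = 4 \<Longrightarrow> F xs = rank_match (?X (xs!0) (xs!1) (xs!2)) (?Y (xs!0) (xs!1) (xs!2)) (xs!3)"
    using computable_rank_match[OF decidable_order_codes decidable_record_codes fin card]
    unfolding computable_def by auto
  obtain G where G: "total_recursive 4 G"
    "\<And>xs. length xs = 4 \<Longrightarrow> G xs = rank_match (?Y (xs!0) (xs!1) (xs!2)) (?X (xs!0) (xs!1) (xs!2)) (xs!3)"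
    using computable_rank_match[OF decidable_record_codes decidable_order_codes fin(2,1) card[symmetric]]
    unfolding computable_def by auto
  have main: "bij_betw (\<Phi> m n \<epsilon>) (perm_order_pairs m n \<epsilon>) (perm_record_pairs m n \<epsilon>)"
    "x \<in> perm_order_pairs m n \<epsilon> \<Longrightarrow> F [m, n, code_signs \<epsilon>, code_order_pair n x] = code_record_pair n \<epsilon> (\<Phi> m n \<epsilon> x)"
    "x \<in> perm_order_pairs m n \<epsilon> \<Longrightarrow> G [m, n, code_signs \<epsilon>, code_record_pair n \<epsilon> (\<Phi> m n \<epsilon> x)] = code_order_pair n x"
    if p: "m \<ge> 1" "n \<ge> 1" "length \<epsilon> = n - 1" for m n \<epsilon> x
  proof -
    have "length (list_decode (code_signs \<epsilon>)) = n - 1" using p by (simp add: code_signs_def)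
    then have XY: "?X m n (code_signs \<epsilon>) = order_codes m n \<epsilon>" "?Y m n (code_signs \<epsilon>) = record_codes m n \<epsilon>"
      using p by (auto simp: valid_order_codes_def valid_record_codes_def valid_parameters_def decode_signs_code)
    note sets = finite_order_codes[of m n \<epsilon>] finite_record_codes[of m n \<epsilon>]
      card_order_codes_eq_card_record_codes[OF p]
    note order_bij = bij_betw_code_order_pair[OF p(2,3), of m]
    note record_bij = bij_betw_code_record_pair[OF p(2,3), of m]
    have "bij_betw (inv_into (perm_record_pairs m n \<epsilon>) (code_record_pair n \<epsilon>) \<circ>
        (rank_match (order_codes m n \<epsilon>) (record_codes m n \<epsilon>) \<circ> code_order_pair n))
        (perm_order_pairs m n \<epsilon>) (perm_record_pairs m n \<epsilon>)"
      using order_bij bij_betw_rank_match[OF sets] bij_betw_inv_into[OF record_bij] by (blast intro: bij_betw_trans)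
    then show "bij_betw (\<Phi> m n \<epsilon>) (perm_order_pairs m n \<epsilon>) (perm_record_pairs m n \<epsilon>)"
      by (rule bij_betw_cong[THEN iffD1, rotated]) (simp add: \<Phi>_def)
    assume "x \<in> perm_order_pairs m n \<epsilon>"
    then have c: "code_order_pair n x \<in> order_codes m n \<epsilon>" using order_bij bij_betwE by blast
    have code: "code_record_pair n \<epsilon> (\<Phi> m n \<epsilon> x) =
        rank_match (order_codes m n \<epsilon>) (record_codes m n \<epsilon>) (code_order_pair n x)"
      unfolding \<Phi>_def using bij_betw_inv_into_right[OF record_bij] rank_match(1)[OF sets c] by blast
    show "F [m, n, code_signs \<epsilon>, code_order_pair n x] = code_record_pair n \<epsilon> (\<Phi> m n \<epsilon> x)"
      by (simp add: F(2) XY code)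
    show "G [m, n, code_signs \<epsilon>, code_record_pair n \<epsilon> (\<Phi> m n \<epsilon> x)] = code_order_pair n x"
      by (simp add: G(2) XY code rank_match_inverse[OF sets c])
  qed
  have "algorithmic_family \<Phi>"
    unfolding algorithmic_family_def using F(1) G(1) main(2,3) by blast
  with main(1) show ?thesis by blast
qed

end
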